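(* Let $(\mathcal{Z},d_\mathcal{Z})$ be a metric space, $P$ a probability distribution on $\mathcal{Z}$, $z_1,\dots,z_n$ i.i.d. from $P$ with empirical distribution $P_n$, and $\epsilon_\mathcal{B}\ge0$. Let $\mathcal{F}$ be a class of functions $\mathcal{Z}\to\mathbb{R}$ and assume: (A1) $\mathrm{diam}(\mathcal{Z}):=\sup_{z,z'\in\mathcal{Z}}d_\mathcal{Z}(z,z')<\infty$; (A2) every $f\in\mathcal{F}$ is upper semicontinuous with $0\le f(z)\le M<\infty$ for all $z$; (A3) for every $f\in\mathcal{F}$ and $z\in\mathcal{Z}$ there exists $\lambda$ with $f(z')-f(z)\le\lambda d_\mathcal{Z}(z,z')$ for all $z'\in\mathcal{Z}$. Then for any $f\in\mathcal{F}$ and $\delta\in(0,1)$, with probability at least $1-\delta$, $$R_{\epsilon_\mathcal{B},1}(P,f)-R_{\epsilon_\mathcal{B},1}(P_n,f)\le\frac{24\,\mathfrak{C}(\mathcal{F})}{\sqrt n}+M\sqrt{\frac{\log(1/\delta)}{2n}}+\frac{12\sqrt\pi}{\sqrt n}\Lambda_{\epsilon_\mathcal{B}}\cdot\mathrm{diam}(\mathcal{Z}).$$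
   Context: Local worst-case risk: $R_{\epsilon,1}(Q,f):=\sup\{\mathbb{E}_{Q'}[f]:W_1(Q,Q')\le\epsilon\}$, where $W_1$ is the 1-Wasserstein distance with respect to $d_\mathcal{Z}$. $\mathfrak{C}(\mathcal{F}):=\int_0^\infty\sqrt{\log\mathcal{N}(\mathcal{F},\|\cdot\|_\infty,u/2)}\,du$ with $\mathcal{N}$ the sup-norm covering number. For an empirical distribution $Q_n$ (uniform on $n$ points of $\mathcal{Z}$) and $f\in\mathcal{F}$: $\psi_{f,Q_n}(\lambda):=\mathbb{E}_{z\sim Q_n}\big(\sup_{z'}\{f(z')-\lambda d_\mathcal{Z}(z,z')-f(z)\}\big)$; $\lambda^+_{f,Q_n}:=\inf\{\lambda:\psi_{f,Q_n}(\lambda)=0\}$; $\lambda^-_{f,Q_n}:=\sup\{\lambda:\psi_{f,Q_n}(\lambda)=\lambda^+_{f,Q_n}\epsilon_\mathcal{B}\}$ if this set is nonempty and $0$ otherwise. Let $[\zeta^-_{f,Q_n},\zeta^+_{f,Q_n}]:=[0,M/\epsilon_\mathcal{B}]$ if $\epsilon_\mathcal{B}\ge M/\lambda^+_{f,Q_n}$ and $:=[\lambda^-_{f,Q_n},\lambda^+_{f,Q_n}]$ otherwise (conventions $M/0=+\infty$). Let $\zeta^-$ and $\zeta^+$ be the infimum of the left endpoints and the supremum of the right endpoints of these intervals over all $f\in\mathcal{F}$ and all empirical distributions $Q_n$ on $\mathcal{Z}$, so that $[\zeta^-,\zeta^+]$ contains their union, and $\Lambda_{\epsilon_\mathcal{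B}}:=\zeta^+-\zeta^-$.
   Formalization: λ ranges over λ ≥ 0, and the supremum defining λ⁻ is taken only over λ ≤ λ⁺; without this the set is unbounded when ε_B = 0 or λ⁺ = 0, so that [λ⁻, λ⁺] is not an interval and the bound fails, e.g. for a constant f. *)

theory Defs
  imports "HOL-Probability.Probability"
begin

definition usc :: "('z::topological_space \<Rightarrow> real) \<Rightarrow> bool" where
  "usc f \<longleftrightarrow> (\<forall>x a. f x < a \<longrightarrow> (\<forall>\<^sub>F y in nhds x. f y < a))"

definition couplings :: "'z::metric_space measure \<Rightarrow> 'z measure \<Rightarrow> ('z \<times> 'z) measure set" where
  "couplings Q Q' = {\<pi>. prob_space \<pi> \<and> sets \<pi> = sets (borel :: ('z \<times> 'z) measure)
       \<and> distr \<pi> borel fst = Q \<and> distr \<pi> borel snd = Q'}"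

(* 1-Wasserstein distance w.r.t. the metric dist (value +\<infinity> if there is no coupling) *)
definition W1 :: "'z::metric_space measure \<Rightarrow> 'z measure \<Rightarrow> ennreal" where
  "W1 Q Q' = (INF \<pi>\<in>couplings Q Q'. \<integral>\<^sup>+ p. ennreal (dist (fst p) (snd p)) \<partial>\<pi>)"

definition worst_risk :: "real \<Rightarrow> 'z::metric_space measure \<Rightarrow> ('z \<Rightarrow> real) \<Rightarrow> real" where
  "worst_risk eps Q f = Sup {integral\<^sup>L Q' f | Q'. prob_space Q' \<and> sets Q' = sets (borel :: 'z measure)
       \<and> W1 Q Q' \<le> ennreal eps}"

definition emp_dist :: "nat \<Rightarrow> (nat \<Rightarrow> 'z::metric_space) \<Rightarrow> 'z measure" where
  "emp_dist n zs = distr (uniform_count_measure {..<n}) borel zs"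

(* sup-norm covering number (external covers); \<infinity> if no finite cover exists *)
definition covering_number :: "('z \<Rightarrow> real) set \<Rightarrow> real \<Rightarrow> enat" where
  "covering_number F u = Inf {enat (card C) | C. finite C \<and>
       (\<forall>f\<in>F. \<exists>g\<in>C. \<forall>z. \<bar>f z - g z\<bar> \<le> u)}"

definition entropy_integral :: "('z \<Rightarrow> real) set \<Rightarrow> ennreal" where
  "entropy_integral F = (\<integral>\<^sup>+ u\<in>{0<..}.
       (case covering_number F (u/2) of enat k \<Rightarrow> ennreal (sqrt (ln (real k))) | \<infinity> \<Rightarrow> \<infinity>) \<partial>lborel)"

(* psi_{f,Q_n}(lambda) for the empirical distribution of zs 0..zs(n-1), expectation written out *)
definition psi :: "('z::metric_space \<Rightarrow> real) \<Rightarrow> nat \<Rightarrow> (nat \<Rightarrow> 'z) \<Rightarrow> real \<Rightarrow> real" where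
  "psi f n zs lam = (\<Sum>i<n. (SUP z'. f z' - lam * dist (zs i) z' - f (zs i))) / real n"

definition lam_plus :: "('z::metric_space \<Rightarrow> real) \<Rightarrow> nat \<Rightarrow> (nat \<Rightarrow> 'z) \<Rightarrow> real" where
  "lam_plus f n zs = Inf {lam. lam \<ge> 0 \<and> psi f n zs lam = 0}"

definition lam_minus :: "real \<Rightarrow> ('z::metric_space \<Rightarrow> real) \<Rightarrow> nat \<Rightarrow> (nat \<Rightarrow> 'z) \<Rightarrow> real" where
  "lam_minus eps f n zs =
     (let S = {lam. 0 \<le> lam \<and> lam \<le> lam_plus f n zs \<and> psi f n zs lam = lam_plus f n zs * eps}
      in if S = {} then 0 else Sup S)"

definition ediv :: "real \<Rightarrow> real \<Rightarrow> ereal" where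
  "ediv a b = (if b = 0 then \<infinity> else ereal (a / b))"

definition zeta_cond :: "real \<Rightarrow> real \<Rightarrow> ('z::metric_space \<Rightarrow> real) \<Rightarrow> nat \<Rightarrow> (nat \<Rightarrow> 'z) \<Rightarrow> bool" where
  "zeta_cond M eps f n zs \<longleftrightarrow> ereal eps \<ge> ediv M (lam_plus f n zs)"

definition zeta_lo :: "real \<Rightarrow> real \<Rightarrow> ('z::metric_space \<Rightarrow> real) \<Rightarrow> nat \<Rightarrow> (nat \<Rightarrow> 'z) \<Rightarrow> ereal" where
  "zeta_lo M eps f n zs = (if zeta_cond M eps f n zs then 0 else ereal (lam_minus eps f n zs))"

definition zeta_hi :: "real \<Rightarrow> real \<Rightarrow> ('z::metric_space \<Rightarrow> real) \<Rightarrow> nat \<Rightarrow> (nat \<Rightarrow> 'z) \<Rightarrow> ereal" where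
  "zeta_hi M eps f n zs = (if zeta_cond M eps f n zs then ediv M eps else ereal (lam_plus f n zs))"

definition Lambda :: "real \<Rightarrow> real \<Rightarrow> ('z::metric_space \<Rightarrow> real) set \<Rightarrow> nat \<Rightarrow> ereal" where
  "Lambda M eps F n = (SUP f\<in>F. SUP zs. zeta_hi M eps f n zs) - (INF f\<in>F. INF zs. zeta_lo M eps f n zs)"

end

theory Submission
  imports Defs
begin

text \<open>
  Only the envelopes \<open>\<phi>\<^sub>\<lambda>(z) = sup\<^sub>z\<^sub>' {f z' - \<lambda> d(z, z')}\<close> of the single
  given \<open>f\<close> matter. Weak duality gives \<open>R(P, f) \<le> \<lambda> \<epsilon> + E\<^sub>P \<phi>\<^sub>\<lambda>\<close> for every \<open>\<lambda> \<ge> 0\<close>; strong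
  duality for the empirical distribution gives the reverse inequality, with \<open>P\<^sub>n\<close> in place of \<open>P\<close>,
  for some \<open>\<lambda>\<close> in \<open>[\<zeta>\<^sup>-, \<zeta>\<^sup>+]\<close>. Hence the risk gap is at most
  \<open>sup\<^sub>\<lambda> (E\<^sub>P \<phi>\<^sub>\<lambda> - E\<^bsub>P\<^sub>n\<^esub> \<phi>\<^sub>\<lambda>)\<close> over this interval. By McDiarmid's inequality the supremum exceeds
  its mean by more than the second term of the bound with probability at most \<open>\<delta>\<close>. Since
  \<open>\<lambda> \<mapsto> \<phi>\<^sub>\<lambda>\<close> is Lipschitz with constant \<open>diam(Z)\<close>, the mean is bounded by the expected total variation
  of the centred process along a grid of \<open>n\<close> steps, at most \<open>\<Lambda> diam(Z) / \<surd>n\<close>, and the grid error is at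
  most the same; \<open>2 \<le> 12 \<surd>\<pi>\<close>. The entropy term is nonnegative.
\<close>

section \<open>Concentration on product spaces\<close>

text \<open>Induction on the index set. Integrating out one coordinate leaves a function with the
  same bounds and the same constants in the other coordinates, while the integrated coordinate
  contributes one factor from Hoeffding's lemma.\<close>

lemma mcdiarmid_mgf:
  fixes M :: "'i \<Rightarrow> 'a measure" and h :: "('i \<Rightarrow> 'a) \<Rightarrow> real"
  assumes prob: "\<And>i. prob_space (M i)" and "finite I"
    and "h \<in> borel_measurable (PiM I M)"
    and "\<And>x. x \<in> space (PiM I M) \<Longrightarrow> \<bar>h x\<bar> \<le> B"
    and "\<And>x i y. \<lbrakk>x \<in> space (PiM I M); i \<in> I; y \<in> space (M i)\<rbrakk> \<Longrightarrow> \<bar>h (x(i := y)) - h x\<bar> \<le> c i"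
    and l: "l > 0"
  shows "(\<integral>x. exp (l * (h x - integral\<^sup>L (PiM I M) h)) \<partial>PiM I M) \<le> exp (l\<^sup>2 * (\<Sum>i\<in>I. (c i)\<^sup>2) / 8)"
  using assms(2-5)
proof (induction I arbitrary: h rule: finite_induct)
  case empty
  show ?case by (simp add: PiM_empty lebesgue_integral_count_space_finite)
next
  case (insert i I)
  interpret product_prob_space M I
    using prob by (simp add: product_prob_space_def product_prob_space_axioms_def product_sigma_finite_def
        prob_space_imp_sigma_finite)
  interpret J: prob_space "PiM (insert i I) M" by (rule prob_space_PiM) (rule prob)
  note hm [measurable] = insert.prems(1)
  note hB = insert.prems(2)
  note hd = insert.prems(3)
  have up: "x(i := y) \<in> space (PiM (insert i I) M)" if "x \<in> space (PiM I M)" "y \<in> space (M i)" for x y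
    using that by (auto simp: space_PiM PiE_def extensional_def Pi_def)
  have int_h: "integrable (PiM (insert i I) M) h"
    by (rule J.integrable_const_bound[where B = B]) (use hB in auto)
  \<comment> \<open>The conditional mean of \<open>h\<close> given the coordinates in
    \<open>I\<close>; \<open>h - h'\<close> plays the part of a martingale difference.\<close>
  define h' where "h' x = (\<integral>y. h (x(i := y)) \<partial>M i)" for x
  have h'm [measurable]: "h' \<in> borel_measurable (PiM I M)"
    unfolding h'_def by measurable
  have int_y: "integrable (M i) (\<lambda>y. h (x(i := y)))" if x: "x \<in> space (PiM I M)" for x
    by (rule M.integrable_const_bound[where B = B])
       (use hB up x insert.hyps in \<open>auto intro!: AE_I2 measurable_compose[OF measurable_component_update hm]\<close>)
  have h'B: "\<bar>h' x\<bar> \<le> B" if x: "x \<in> space (PiM I M)" for x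
  proof -
    have "norm (h' x) \<le> (\<integral>y. norm (h (x(i := y))) \<partial>M i)"
      unfolding h'_def by (rule integral_norm_bound)
    also have "\<dots> \<le> B"
      by (rule M.integral_le_const) (use int_y[OF x] up[OF x] hB in \<open>auto intro!: AE_I2\<close>)
    finally show ?thesis by simp
  qed
  have h'd: "\<bar>h' (x(j := y)) - h' x\<bar> \<le> c j" if x: "x \<in> space (PiM I M)" and j: "j \<in> I" and y: "y \<in> space (M j)" for x j y
  proof -
    have x': "x(j := y) \<in> space (PiM I M)"
      using x y j by (auto simp: space_PiM PiE_def extensional_def Pi_def)
    have ji: "j \<noteq> i" using j insert.hyps by auto
    have "h' (x(j := y)) - h' x = (\<integral>v. h (x(j := y, i := v)) - h (x(i := v)) \<partial>M i)"
      unfolding h'_def using int_y[OF x] int_y[OF x'] by simp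
    also have "norm \<dots> \<le> (\<integral>v. norm (h (x(j := y, i := v)) - h (x(i := v))) \<partial>M i)"
      by (rule integral_norm_bound)
    also have "\<dots> \<le> c j"
    proof (rule M.integral_le_const)
      show "integrable (M i) (\<lambda>v. norm (h (x(j := y, i := v)) - h (x(i := v))))"
        using int_y[OF x] int_y[OF x'] by auto
      show "AE v in M i. norm (h (x(j := y, i := v)) - h (x(i := v))) \<le> c j"
      proof (rule AE_I2)
        fix v assume v: "v \<in> space (M i)"
        have eq: "x(j := y, i := v) = x(i := v, j := y)" using ji by (auto simp: fun_upd_twist)
        show "norm (h (x(j := y, i := v)) - h (x(i := v))) \<le> c j"
          unfolding eq real_norm_def by (rule hd[OF up[OF x v]]) (use j y in auto)
      qed
    qed
    finally show ?thesis by simp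
  qed
  have Eh: "integral\<^sup>L (PiM (insert i I) M) h = integral\<^sup>L (PiM I M) h'"
    unfolding h'_def by (rule product_integral_insert[OF insert.hyps int_h])
  define \<mu> where "\<mu> = integral\<^sup>L (PiM I M) h'"
  have B0: "B \<ge> 0"
  proof -
    obtain x where "x \<in> space (PiM (insert i I) M)" using J.not_empty by blast
    then show ?thesis using hB[of x] by auto
  qed
  have \<mu>B: "\<bar>\<mu>\<bar> \<le> B"
  proof -
    have "norm \<mu> \<le> (\<integral>x. norm (h x) \<partial>PiM (insert i I) M)"
      unfolding \<mu>_def Eh[symmetric] by (rule integral_norm_bound)
    also have "\<dots> \<le> B"
      by (rule J.integral_le_const) (use int_h hB in \<open>auto intro!: AE_I2\<close>)
    finally show ?thesis by simp
  qed
  have exp_bd: "exp (l * (a - b)) \<le> exp (l * (2 * B))" if "\<bar>a\<bar> \<le> B" "\<bar>b\<bar> \<le> B" for a b :: real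
    using that l by (simp add: abs_le_iff)
  have int_e: "integrable (PiM (insert i I) M) (\<lambda>x. exp (l * (h x - \<mu>)))"
    by (rule J.integrable_const_bound[where B = "exp (l * (2 * B))"])
       (use hB \<mu>B exp_bd in \<open>auto intro!: AE_I2\<close>)
  have int_e': "integrable (PiM I M) (\<lambda>x. exp (l * (h' x - \<mu>)))"
    by (rule P.integrable_const_bound[where B = "exp (l * (2 * B))"])
       (use h'B \<mu>B exp_bd in \<open>auto intro!: AE_I2\<close>)
  have hoeff: "(\<integral>y. exp (l * (h (x(i := y)) - h' x)) \<partial>M i) \<le> exp (l\<^sup>2 * (c i)\<^sup>2 / 8)"
    if x: "x \<in> space (PiM I M)" for x
  proof -
    \<comment> \<open>Hoeffding's lemma asks for an enclosing interval. The infimum and supremum of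
      the slice provide one, and bounded differences limit its length to \<open>c i\<close>.\<close>
    let ?g = "\<lambda>y. h (x(i := y))"
    let ?a = "INF y\<in>space (M i). ?g y"
    let ?b = "SUP y\<in>space (M i). ?g y"
    have ne: "space (M i) \<noteq> {}" by (rule M.not_empty)
    have gB: "\<bar>?g y\<bar> \<le> B" if "y \<in> space (M i)" for y using hB up x that by auto
    have bb: "bdd_below (?g ` space (M i))" "bdd_above (?g ` space (M i))"
      using gB by (auto intro!: bdd_belowI[of _ "-B"] bdd_aboveI[of _ B] simp: abs_le_iff minus_le_iff)
    have ab: "?g y \<in> {?a..?b}" if "y \<in> space (M i)" for y
      using that bb by (auto intro!: cINF_lower cSUP_upper)
    have diff: "?b - ?a \<le> c i"
    proof -
      have "?b \<le> ?a + c i"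
      proof (rule cSUP_least[OF ne])
        fix y assume y: "y \<in> space (M i)"
        have "?g y - c i \<le> ?a"
        proof (rule cINF_greatest[OF ne])
          fix w assume w: "w \<in> space (M i)"
          show "?g y - c i \<le> ?g w"
            using hd[OF up[OF x w] insertI1 y] unfolding fun_upd_upd by (simp only: abs_le_iff) linarith
        qed
        then show "?g y \<le> ?a + c i" by simp
      qed
      then show ?thesis by simp
    qed
    have ab0: "?b - ?a \<ge> 0" using ne ab by fastforce
    interpret H: interval_bounded_random_variable "M i" ?g ?a ?b
    proof
      show "?g \<in> borel_measurable (M i)"
        by (rule measurable_compose[OF measurable_component_update hm]) (use x insert.hyps in auto)
      show "AE y in M i. ?g y \<in> {?a..?b}" using ab by auto
    qed
    have gm [measurable]: "?g \<in> borel_measurable (M i)"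
      by (rule measurable_compose[OF measurable_component_update hm]) (use x insert.hyps in auto)
    have int: "integrable (M i) (\<lambda>y. exp (l * (?g y - h' x)))"
      by (rule M.integrable_const_bound[where B = "exp (l * (2 * B))"])
         (use gB h'B[OF x] exp_bd in \<open>auto intro!: AE_I2\<close>)
    have "ennreal (\<integral>y. exp (l * (?g y - h' x)) \<partial>M i) = (\<integral>\<^sup>+y. exp (l * (?g y - h' x)) \<partial>M i)"
      by (rule nn_integral_eq_integral[symmetric, OF int]) auto
    also have "\<dots> \<le> ennreal (exp (l\<^sup>2 * (?b - ?a)\<^sup>2 / 8))"
      using H.Hoeffdings_lemma_nn_integral[OF l] unfolding h'_def .
    finally have "(\<integral>y. exp (l * (?g y - h' x)) \<partial>M i) \<le> exp (l\<^sup>2 * (?b - ?a)\<^sup>2 / 8)"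
      by simp
    also have "\<dots> \<le> exp (l\<^sup>2 * (c i)\<^sup>2 / 8)"
      using diff ab0 by (simp add: mult_left_mono power_mono)
    finally show ?thesis .
  qed
  have "(\<integral>x. exp (l * (h x - \<mu>)) \<partial>PiM (insert i I) M)
      = (\<integral>x. (\<integral>y. exp (l * (h (x(i := y)) - \<mu>)) \<partial>M i) \<partial>PiM I M)"
    by (rule product_integral_insert[OF insert.hyps int_e])
  \<comment> \<open>Split \<open>h - \<mu>\<close> into \<open>h' - \<mu>\<close>, constant in the
    inner variable, and the increment controlled by \<open>hoeff\<close>.\<close>
  also have "\<dots> = (\<integral>x. exp (l * (h' x - \<mu>)) * (\<integral>y. exp (l * (h (x(i := y)) - h' x)) \<partial>M i) \<partial>PiM I M)"
  proof (rule Bochner_Integration.integral_cong[OF refl])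
    fix x
    have "exp (l * (h (x(i := y)) - \<mu>)) = exp (l * (h' x - \<mu>)) * exp (l * (h (x(i := y)) - h' x))" for y
      by (simp add: exp_add[symmetric] algebra_simps)
    then show "(\<integral>y. exp (l * (h (x(i := y)) - \<mu>)) \<partial>M i)
      = exp (l * (h' x - \<mu>)) * (\<integral>y. exp (l * (h (x(i := y)) - h' x)) \<partial>M i)"
      by simp
  qed
  also have "\<dots> \<le> (\<integral>x. exp (l * (h' x - \<mu>)) * exp (l\<^sup>2 * (c i)\<^sup>2 / 8) \<partial>PiM I M)"
    by (rule integral_mono') (use int_e' hoeff in \<open>auto intro!: mult_left_mono\<close>)
  also have "\<dots> = (\<integral>x. exp (l * (h' x - \<mu>)) \<partial>PiM I M) * exp (l\<^sup>2 * (c i)\<^sup>2 / 8)"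
    by simp
  also have "\<dots> \<le> exp (l\<^sup>2 * (\<Sum>i\<in>I. (c i)\<^sup>2) / 8) * exp (l\<^sup>2 * (c i)\<^sup>2 / 8)"
    unfolding \<mu>_def by (intro mult_right_mono insert.IH h'm h'B h'd) auto
  also have "\<dots> = exp (l\<^sup>2 * (\<Sum>i\<in>insert i I. (c i)\<^sup>2) / 8)"
    using insert.hyps by (simp add: exp_add[symmetric] field_simps)
  finally show ?case unfolding Eh \<mu>_def .
qed

text \<open>Chernoff's method: Markov's inequality for the exponential moment.\<close>

lemma mcdiarmid:
  fixes M :: "'i \<Rightarrow> 'a measure" and h :: "('i \<Rightarrow> 'a) \<Rightarrow> real"
  assumes prob: "\<And>i. prob_space (M i)" and fin: "finite I"
    and hm [measurable]: "h \<in> borel_measurable (PiM I M)"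
    and hB: "\<And>x. x \<in> space (PiM I M) \<Longrightarrow> \<bar>h x\<bar> \<le> B"
    and hd: "\<And>x i y. \<lbrakk>x \<in> space (PiM I M); i \<in> I; y \<in> space (M i)\<rbrakk> \<Longrightarrow> \<bar>h (x(i := y)) - h x\<bar> \<le> c i"
    and c: "(\<Sum>i\<in>I. (c i)\<^sup>2) > 0" and t: "t > 0"
  shows "measure (PiM I M) {x \<in> space (PiM I M). h x \<ge> integral\<^sup>L (PiM I M) h + t}
           \<le> exp (- (2 * t\<^sup>2 / (\<Sum>i\<in>I. (c i)\<^sup>2)))"
proof -
  interpret prob_space "PiM I M" by (rule prob_space_PiM) (rule prob)
  define S where "S = (\<Sum>i\<in>I. (c i)\<^sup>2)"
  \<comment> \<open>This value minimises the exponent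
    \<open>l\<^sup>2 * S / 8 - l * t\<close>.\<close>
  define l where "l = 4 * t / S"
  define \<mu> where "\<mu> = expectation h"
  have S: "S > 0" using c S_def by simp
  have l: "l > 0" using S t by (simp add: l_def)
  have int: "integrable (PiM I M) (\<lambda>x. exp (l * (h x - \<mu>)))"
  proof (rule integrable_const_bound[where B = "exp (l * (B - \<mu>))"])
    show "AE x in PiM I M. norm (exp (l * (h x - \<mu>))) \<le> exp (l * (B - \<mu>))"
      using hB l by (auto intro!: AE_I2 simp: abs_le_iff)
  qed measurable
  have "{x \<in> space (PiM I M). h x \<ge> \<mu> + t} = {x \<in> space (PiM I M). exp (l * t) \<le> exp (l * (h x - \<mu>))}"
    using l by (auto simp: le_diff_eq add.commute)
  then have "prob {x \<in> space (PiM I M). h x \<ge> \<mu> + t} \<le> expectation (\<lambda>x. exp (l * (h x - \<mu>))) / exp (l * t)"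
    using integral_Markov_inequality_measure[OF int sets.empty_sets, of "exp (l * t)"] by simp
  also have "\<dots> \<le> exp (l\<^sup>2 * S / 8) / exp (l * t)"
    unfolding S_def \<mu>_def by (intro divide_right_mono mcdiarmid_mgf[where B = B]) (use assms l in auto)
  also have "\<dots> = exp (- (2 * t\<^sup>2 / S))"
    unfolding exp_diff[symmetric] l_def using S by (simp add: field_simps power2_eq_square)
  finally show ?thesis unfolding \<mu>_def S_def .
qed

text \<open>Variances of independent centred variables add: integrating over the inserted coordinate
  kills the cross term. Boundedness supplies integrability.\<close>

lemma second_moment_sum_PiM:
  fixes M :: "'i \<Rightarrow> 'a measure" and u :: "'i \<Rightarrow> 'a \<Rightarrow> real"
  assumes prob: "\<And>i. prob_space (M i)" and "finite I"
    and um [measurable]: "\<And>i. u i \<in> borel_measurable (M i)"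
    and uB: "\<And>i x. x \<in> space (M i) \<Longrightarrow> \<bar>u i x\<bar> \<le> B"
    and u0: "\<And>i. integral\<^sup>L (M i) (u i) = 0"
  shows "(\<integral>x. (\<Sum>i\<in>I. u i (x i))\<^sup>2 \<partial>PiM I M) = (\<Sum>i\<in>I. \<integral>y. (u i y)\<^sup>2 \<partial>M i)"
  using assms(2)
proof (induction I rule: finite_induct)
  case empty
  then show ?case by simp
next
  case (insert i I)
  interpret product_prob_space M I
    using prob by (simp add: product_prob_space_def product_prob_space_axioms_def product_sigma_finite_def
        prob_space_imp_sigma_finite)
  have int1: "integrable (M i) (u i)" for i
    by (rule M.integrable_const_bound[where B = B]) (use uB in auto)
  have int2: "integrable (M i) (\<lambda>y. (u i y)\<^sup>2)" for i
    by (rule M.integrable_const_bound[where B = "B\<^sup>2"])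
       (use uB in \<open>auto intro!: AE_I2 power2_le_iff_abs_le[THEN iffD2] intro: order_trans[OF abs_ge_zero]\<close>)
  have bd: "\<bar>\<Sum>j\<in>J. u j (x j)\<bar> \<le> real (card J) * B" if "x \<in> space (PiM J M)" for J x
    using that by (intro order_trans[OF sum_abs] sum_bounded_above uB) (auto simp: space_PiM)
  have int3: "integrable (PiM J M) (\<lambda>x. (\<Sum>j\<in>J. u j (x j))\<^sup>2)" for J
  proof -
    interpret J: prob_space "PiM J M" by (rule prob_space_PiM) (rule prob)
    show ?thesis
    proof (rule J.integrable_const_bound[where B = "(real (card J) * B)\<^sup>2"])
      show "AE x in PiM J M. norm ((\<Sum>j\<in>J. u j (x j))\<^sup>2) \<le> (real (card J) * B)\<^sup>2"
        using bd[of _ J] by (auto intro!: AE_I2 power2_le_iff_abs_le[THEN iffD2] intro: order_trans[OF abs_ge_zero])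
    qed measurable
  qed
  have "(\<integral>x. (\<Sum>i\<in>insert i I. u i (x i))\<^sup>2 \<partial>PiM (insert i I) M)
      = (\<integral>x. (\<integral>y. (\<Sum>j\<in>insert i I. u j ((x(i := y)) j))\<^sup>2 \<partial>M i) \<partial>PiM I M)"
    by (rule product_integral_insert[OF insert.hyps int3])
  also have "\<dots> = (\<integral>x. (\<integral>y. (u i y)\<^sup>2 \<partial>M i) + (\<Sum>j\<in>I. u j (x j))\<^sup>2 \<partial>PiM I M)"
  proof (rule Bochner_Integration.integral_cong[OF refl])
    fix x
    have *: "(\<Sum>j\<in>I. u j ((x(i := y)) j)) = (\<Sum>j\<in>I. u j (x j))" for y
      using insert.hyps by (intro sum.cong) auto
    have "(\<integral>y. (\<Sum>j\<in>insert i I. u j ((x(i := y)) j))\<^sup>2 \<partial>M i)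
        = (\<integral>y. (u i y)\<^sup>2 + (\<Sum>j\<in>I. u j (x j))\<^sup>2 + 2 * (\<Sum>j\<in>I. u j (x j)) * u i y \<partial>M i)"
      using insert.hyps * by (intro Bochner_Integration.integral_cong) (auto simp: power2_sum algebra_simps)
    also have "\<dots> = (\<integral>y. (u i y)\<^sup>2 \<partial>M i) + (\<Sum>j\<in>I. u j (x j))\<^sup>2"
      using int1[of i] int2[of i] by (simp add: u0 M.prob_space)
    finally show "(\<integral>y. (\<Sum>j\<in>insert i I. u j ((x(i := y)) j))\<^sup>2 \<partial>M i)
        = (\<integral>y. (u i y)\<^sup>2 \<partial>M i) + (\<Sum>j\<in>I. u j (x j))\<^sup>2" .
  qed
  also have "\<dots> = (\<integral>y. (u i y)\<^sup>2 \<partial>M i) + (\<integral>x. (\<Sum>j\<in>I. u j (x j))\<^sup>2 \<partial>PiM I M)"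
    using int3 P.prob_space by simp
  finally show ?case using insert by simp
qed

text \<open>This is nonnegativity of the variance of the absolute value.\<close>

lemma (in prob_space) expectation_abs_le_sqrt:
  assumes [measurable]: "X \<in> borel_measurable M" and "integrable M (\<lambda>x. (X x)\<^sup>2 :: real)"
  shows "expectation (\<lambda>x. \<bar>X x\<bar>) \<le> sqrt (expectation (\<lambda>x. (X x)\<^sup>2))"
proof -
  have int: "integrable M X" using assms square_integrable_imp_integrable by blast
  have "0 \<le> variance (\<lambda>x. \<bar>X x\<bar>)" by (rule variance_positive)
  also have "\<dots> = expectation (\<lambda>x. (X x)\<^sup>2) - (expectation (\<lambda>x. \<bar>X x\<bar>))\<^sup>2"
    using int assms by (subst variance_eq) auto
  finally show ?thesis by (intro real_le_rsqrt) simp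
qed

section \<open>Duality for the worst-case risk\<close>

text \<open>This is the c-transform of Kantorovich duality for the cost \<open>lam * dist\<close>,
  also known as a Pasch-Hausdorff envelope.\<close>

definition envelope :: "('z::metric_space \<Rightarrow> real) \<Rightarrow> real \<Rightarrow> 'z \<Rightarrow> real" where
  "envelope f lam z = (SUP z'. f z' - lam * dist z z')"

text \<open>Finitely supported transport plans out of the empirical distribution. They suffice for a lower
  bound on the worst-case risk, and as pmfs they can be mixed with \<open>bind_pmf\<close>.\<close>

definition plans :: "nat \<Rightarrow> (nat \<Rightarrow> 'z) \<Rightarrow> ('z \<times> 'z) pmf set" where
  "plans n zs = {p. finite (set_pmf p) \<and> map_pmf fst p = map_pmf zs (pmf_of_set {..<n})}"

definition cost :: "('z::metric_space \<times> 'z) pmf \<Rightarrow> real" where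
  "cost p = measure_pmf.expectation p (\<lambda>(x, y). dist x y)"

section \<open>Borel couplings and mixtures of transport plans\<close>

text \<open>Without separability the Borel sets of the product space may exceed the product
  sigma-algebra. Couplings live on the former, where continuity gives measurability.\<close>

lemma coupling_dist_measurable:
  assumes [measurable_cong]: "sets \<pi> = sets (borel :: ('z::metric_space \<times> 'z) measure)"
  shows "fst \<in> \<pi> \<rightarrow>\<^sub>M (borel :: 'z measure)" "snd \<in> \<pi> \<rightarrow>\<^sub>M (borel :: 'z measure)"
    "(\<lambda>p. dist (fst p) (snd p)) \<in> borel_measurable \<pi>"
proof -
  have "fst \<in> (borel :: ('z \<times> 'z) measure) \<rightarrow>\<^sub>M (borel :: 'z measure)"
    "snd \<in> (borel :: ('z \<times> 'z) measure) \<rightarrow>\<^sub>M (borel :: 'z measure)"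
    "(\<lambda>p. dist (fst p) (snd p)) \<in> borel_measurable (borel :: ('z \<times> 'z) measure)"
    by (intro borel_measurable_continuous_onI continuous_intros)+
  then show "fst \<in> \<pi> \<rightarrow>\<^sub>M (borel :: 'z measure)" "snd \<in> \<pi> \<rightarrow>\<^sub>M (borel :: 'z measure)"
    "(\<lambda>p. dist (fst p) (snd p)) \<in> borel_measurable \<pi>"
    using measurable_cong_sets[OF assms refl] by blast+
qed

text \<open>The diagonal coupling costs nothing. Hence the set in \<open>worst_risk\<close> is
  nonempty for nonnegative radius.\<close>

lemma W1_self:
  assumes "prob_space Q" and [measurable_cong]: "sets Q = sets (borel :: 'z::metric_space measure)"
  shows "W1 Q Q = 0"
proof -
  interpret prob_space Q by fact
  have "(\<lambda>x::'z. (x, x)) \<in> borel \<rightarrow>\<^sub>M borel"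
    by (intro borel_measurable_continuous_onI continuous_intros)
  then have diag [measurable]: "(\<lambda>x::'z. (x, x)) \<in> Q \<rightarrow>\<^sub>M borel"
    using measurable_cong_sets[OF assms(2) refl] by blast
  define \<pi> where "\<pi> = distr Q (borel :: ('z \<times> 'z) measure) (\<lambda>x. (x, x))"
  have s: "sets \<pi> = sets borel" by (simp add: \<pi>_def)
  have "distr Q borel (\<lambda>x. x) = Q" by (rule distr_id2) (simp add: assms)
  then have "\<pi> \<in> couplings Q Q"
    using coupling_dist_measurable[of "borel :: ('z \<times> 'z) measure"] unfolding couplings_def
    by (auto simp: \<pi>_def distr_distr comp_def intro!: prob_space_distr)
  then have "W1 Q Q \<le> (\<integral>\<^sup>+ p. ennreal (dist (fst p) (snd p)) \<partial>\<pi>)"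
    unfolding W1_def by (rule INF_lower)
  also have "\<dots> = 0"
    using coupling_dist_measurable[of "borel :: ('z \<times> 'z) measure"] unfolding \<pi>_def
    by (subst nn_integral_distr) auto
  finally show ?thesis by simp
qed

text \<open>Bridge between pmfs, which measure all subsets, and Borel measures: the identity map
  restricts the former to Borel sets.\<close>

lemma emp_dist_pmf:
  fixes zs :: "nat \<Rightarrow> 'z::metric_space"
  assumes "n > 0"
  shows "emp_dist n zs = distr (measure_pmf (map_pmf zs (pmf_of_set {..<n}))) borel (\<lambda>x. x)"
proof (rule measure_eqI)
  show "sets (emp_dist n zs) = sets (distr (measure_pmf (map_pmf zs (pmf_of_set {..<n}))) borel (\<lambda>x. x))"
    by (simp add: emp_dist_def)
  fix A assume A: "A \<in> sets (emp_dist n zs)"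
  have m: "zs \<in> uniform_count_measure {..<n} \<rightarrow>\<^sub>M borel"
    by (simp add: measurable_def sets_uniform_count_measure space_uniform_count_measure)
  have "emeasure (emp_dist n zs) A = emeasure (uniform_count_measure {..<n}) (zs -` A \<inter> {..<n})"
    using A m by (simp add: emp_dist_def emeasure_distr space_uniform_count_measure)
  also have "\<dots> = emeasure (measure_pmf (pmf_of_set {..<n})) (zs -` A)"
    using assms by (subst emeasure_uniform_count_measure) (auto simp: emeasure_pmf_of_set Int_commute lessThan_empty_iff)
  also have "\<dots> = emeasure (distr (measure_pmf (map_pmf zs (pmf_of_set {..<n}))) borel (\<lambda>x. x)) A"
    using A by (simp add: emp_dist_def emeasure_distr)
  finally show "emeasure (emp_dist n zs) A = emeasure (distr (measure_pmf (map_pmf zs (pmf_of_set {..<n}))) borel (\<lambda>x. x)) A" .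
qed

lemma expectation_mix_pmf:
  fixes g :: "'a \<Rightarrow> real"
  assumes "finite (set_pmf p)" "finite (set_pmf q)" "0 \<le> t" "t \<le> 1"
  shows "measure_pmf.expectation (bernoulli_pmf t \<bind> (\<lambda>b. if b then p else q)) g
    = t * measure_pmf.expectation p g + (1 - t) * measure_pmf.expectation q g"
  using assms by (subst pmf_expectation_bind[where A = UNIV]) (auto simp: UNIV_bool)

text \<open>Both branches have the same first marginal, so the random choice of branch does not
  affect it.\<close>

lemma mix_in_plans:
  assumes "p \<in> plans n zs" "q \<in> plans n zs"
  shows "bernoulli_pmf t \<bind> (\<lambda>b. if b then p else q) \<in> plans n zs"
proof -
  have "map_pmf fst (bernoulli_pmf t \<bind> (\<lambda>b. if b then p else q)) = bernoulli_pmf t \<bind> (\<lambda>b. map_pmf zs (pmf_of_set {..<n}))"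
    unfolding map_bind_pmf using assms by (intro bind_pmf_cong) (auto simp: plans_def)
  then show ?thesis
    using assms by (auto simp: plans_def set_bind_pmf)
qed

section \<open>Envelopes as functions of the multiplier and of the point\<close>

text \<open>\<open>D\<close> is any bound on the distances; it is instantiated with the diameter in
  the end.\<close>

locale bounded_usc =
  fixes f :: "'z::metric_space \<Rightarrow> real" and M D :: real
  assumes dist_le_D: "dist (x :: 'z) y \<le> D"
    and usc: "usc f" and f_nonneg: "0 \<le> f z" and f_le: "f z \<le> M"
begin

lemma D_nonneg: "0 \<le> D"
  using dist_le_D[of undefined undefined] by simp

lemma M_nonneg: "0 \<le> M"
  using f_nonneg f_le order_trans by blast

lemma f_measurable [measurable]: "f \<in> borel_measurable borel"
  unfolding borel_measurable_iff_less
proof safe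
  fix a
  have "open {x. f x < a}"
    using usc by (subst open_subopen) (fastforce simp: usc_def eventually_nhds)
  then show "{w \<in> space borel. f w < a} \<in> sets borel" by simp
qed

lemma envelope_bdd: "0 \<le> lam \<Longrightarrow> bdd_above (range (\<lambda>z'. f z' - lam * dist z z'))"
  by (rule bdd_aboveI[of _ M])
     (use f_le in \<open>auto intro!: diff_le_eq[THEN iffD2] add_increasing2\<close>)

lemma envelope_ge: "0 \<le> lam \<Longrightarrow> f z' - lam * dist z z' \<le> envelope f lam z"
  unfolding envelope_def by (rule cSUP_upper[OF UNIV_I envelope_bdd])

lemma envelope_le: "(\<And>z'. f z' - lam * dist z z' \<le> c) \<Longrightarrow> envelope f lam z \<le> c"
  unfolding envelope_def by (rule cSUP_least) auto

lemma envelope_ge_f: "0 \<le> lam \<Longrightarrow> f z \<le> envelope f lam z"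
  using envelope_ge[of lam z z] by simp

lemma envelope_nonneg: "0 \<le> lam \<Longrightarrow> 0 \<le> envelope f lam z"
  using envelope_ge_f f_nonneg order_trans by blast

lemma envelope_le_M: "0 \<le> lam \<Longrightarrow> envelope f lam z \<le> M"
  by (rule envelope_le) (use f_le in \<open>auto intro!: diff_le_eq[THEN iffD2] add_increasing2\<close>)

lemma envelope_antimono: "0 \<le> lam \<Longrightarrow> lam \<le> mu \<Longrightarrow> envelope f mu z \<le> envelope f lam z"
proof (rule envelope_le)
  fix z' assume "0 \<le> lam" "lam \<le> mu"
  then have "f z' - mu * dist z z' \<le> f z' - lam * dist z z'" by (simp add: mult_right_mono)
  also have "\<dots> \<le> envelope f lam z" using \<open>0 \<le> lam\<close> by (rule envelope_ge)
  finally show "f z' - mu * dist z z' \<le> envelope f lam z" .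
qed

text \<open>Each term of the supremum moves by at most \<open>(mu - lam) * D\<close>. This is where
  the diameter enters the bound.\<close>

lemma envelope_lipschitz_param:
  assumes "0 \<le> lam" "lam \<le> mu"
  shows "envelope f lam z \<le> envelope f mu z + (mu - lam) * D"
proof (rule envelope_le)
  fix z'
  have "f z' - lam * dist z z' = (f z' - mu * dist z z') + (mu - lam) * dist z z'"
    by (simp add: algebra_simps)
  also have "\<dots> \<le> envelope f mu z + (mu - lam) * D"
    using assms by (intro add_mono envelope_ge mult_left_mono dist_le_D) auto
  finally show "f z' - lam * dist z z' \<le> envelope f mu z + (mu - lam) * D" .
qed

lemma envelope_lipschitz:
  assumes "0 \<le> lam" shows "envelope f lam x \<le> envelope f lam y + lam * dist x y"
proof (rule envelope_le)
  fix z'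
  have "lam * dist y z' \<le> lam * (dist x y + dist x z')"
    using assms by (intro mult_left_mono) (metis dist_commute dist_triangle, auto)
  then have "f z' - lam * dist x z' \<le> (f z' - lam * dist y z') + lam * dist x y"
    by (simp add: algebra_simps)
  also have "\<dots> \<le> envelope f lam y + lam * dist x y" using envelope_ge[OF assms] by simp
  finally show "f z' - lam * dist x z' \<le> envelope f lam y + lam * dist x y" .
qed

text \<open>A supremum over possibly uncountably many points is measurable here because it is
  Lipschitz in \<open>z\<close>, although \<open>f\<close> is only semicontinuous.\<close>

lemma envelope_measurable [measurable]:
  assumes "0 \<le> lam" shows "envelope f lam \<in> borel_measurable borel"
proof (rule borel_measurable_continuous_onI)
  have "lam-lipschitz_on UNIV (envelope f lam)"
    using assms
    by (intro lipschitz_onI)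
       (smt (verit, best) dist_commute dist_real_def envelope_lipschitz)+
  then show "continuous_on UNIV (envelope f lam)" by (rule lipschitz_on_continuous_on)
qed

lemma psi_envelope:
  assumes "0 \<le> lam"
  shows "psi f n zs lam = (\<Sum>i<n. envelope f lam (zs i) - f (zs i)) / real n"
proof -
  have "(SUP z'. f z' - lam * dist x z' - f x) = envelope f lam x - f x" for x
  proof (rule antisym)
    show "(SUP z'. f z' - lam * dist x z' - f x) \<le> envelope f lam x - f x"
      by (rule cSUP_least) (use envelope_ge[OF assms] in auto)
    have "bdd_above (range (\<lambda>z'. f z' - lam * dist x z' - f x))"
      by (rule bdd_aboveI[of _ "envelope f lam x - f x"]) (use envelope_ge[OF assms] in auto)
    then have "f z' - lam * dist x z' - f x \<le> (SUP z'. f z' - lam * dist x z' - f x)" for z'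
      by (rule cSUP_upper[OF UNIV_I])
    then have "envelope f lam x \<le> (SUP z'. f z' - lam * dist x z' - f x) + f x"
      by (intro envelope_le) (simp add: diff_le_eq)
    then show "envelope f lam x - f x \<le> (SUP z'. f z' - lam * dist x z' - f x)"
      by simp
  qed
  then show ?thesis unfolding psi_def by simp
qed

section \<open>Weak duality for the worst-case risk\<close>

lemma worst_risk_bdd:
  "bdd_above {integral\<^sup>L Q' f | Q'. prob_space Q' \<and> sets Q' = sets (borel :: 'z measure) \<and> W1 Q Q' \<le> ennreal eps}"
proof (rule bdd_aboveI[of _ M], safe)
  fix Q' :: "'z measure" assume "prob_space Q'" and [measurable_cong]: "sets Q' = sets borel"
  then interpret prob_space Q' by simp
  have "integrable Q' f"
    by (rule integrable_const_bound[where B = M]) (use f_nonneg f_le in auto)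
  then show "integral\<^sup>L Q' f \<le> M"
    by (rule integral_le_const) (use f_le in auto)
qed

text \<open>Integrate \<open>f y \<le> envelope f lam x + lam * dist x y\<close> against a nearly
  optimal coupling.\<close>

lemma worst_risk_upper:
  assumes "prob_space Q" and sQ [measurable_cong]: "sets Q = sets (borel :: 'z measure)"
    and lam: "0 \<le> lam" and eps: "0 \<le> eps"
  shows "worst_risk eps Q f \<le> lam * eps + integral\<^sup>L Q (envelope f lam)"
  unfolding worst_risk_def
proof (rule cSup_least)
  have "W1 Q Q \<le> ennreal eps" using W1_self[OF assms(1,2)] by simp
  then show "{integral\<^sup>L Q' f | Q'. prob_space Q' \<and> sets Q' = sets (borel :: 'z measure) \<and> W1 Q Q' \<le> ennreal eps} \<noteq> {}"
    using assms by blast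
next
  fix r assume "r \<in> {integral\<^sup>L Q' f | Q'. prob_space Q' \<and> sets Q' = sets (borel :: 'z measure) \<and> W1 Q Q' \<le> ennreal eps}"
  then obtain Q' where r: "r = integral\<^sup>L Q' f" and "prob_space Q'" "sets Q' = sets (borel :: 'z measure)"
    and W: "W1 Q Q' \<le> ennreal eps" by blast
  show "r \<le> lam * eps + integral\<^sup>L Q (envelope f lam)"
  proof (rule field_le_epsilon)
    fix e :: real assume e: "0 < e"
    \<comment> \<open>The infimum in \<open>W1\<close> need not be attained. This slack satisfies
      \<open>lam * e' \<le> e\<close>, and the added \<open>1\<close> covers
      \<open>lam = 0\<close>.\<close>
    define e' where "e' = e / (lam + 1)"
    have e': "0 < e'" using e lam by (simp add: e'_def)
    have "W1 Q Q' < ennreal (eps + e')"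
      using W e' eps by (auto intro!: le_less_trans[OF W] simp: ennreal_less_iff)
    then obtain \<pi> where \<pi>: "\<pi> \<in> couplings Q Q'" and c: "(\<integral>\<^sup>+ p. ennreal (dist (fst p) (snd p)) \<partial>\<pi>) < ennreal (eps + e')"
      unfolding W1_def INF_less_iff by blast
    have s: "sets \<pi> = sets (borel :: ('z \<times> 'z) measure)" and Q: "distr \<pi> borel fst = Q" and Q': "distr \<pi> borel snd = Q'"
      using \<pi> by (auto simp: couplings_def)
    interpret \<pi>: prob_space \<pi> using \<pi> by (simp add: couplings_def)
    note m [measurable] = coupling_dist_measurable[OF s]
    have [measurable]: "envelope f lam \<in> borel_measurable borel" by (rule envelope_measurable[OF lam])
    have i1: "integrable \<pi> (\<lambda>p. f (snd p))"
      by (rule \<pi>.integrable_const_bound[where B = M]) (use f_nonneg f_le in auto)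
    have i2: "integrable \<pi> (\<lambda>p. envelope f lam (fst p))"
      by (rule \<pi>.integrable_const_bound[where B = M]) (use envelope_nonneg envelope_le_M lam in auto)
    have i3: "integrable \<pi> (\<lambda>p. dist (fst p) (snd p))"
      by (rule \<pi>.integrable_const_bound[where B = D]) (use dist_le_D in auto)
    have "ennreal (\<integral>p. dist (fst p) (snd p) \<partial>\<pi>) < ennreal (eps + e')"
      using c nn_integral_eq_integral[OF i3] by simp
    then have c': "(\<integral>p. dist (fst p) (snd p) \<partial>\<pi>) \<le> eps + e'"
      by (subst (asm) ennreal_less_iff) auto
    have "r = (\<integral>p. f (snd p) \<partial>\<pi>)"
      unfolding r Q'[symmetric] by (rule integral_distr) auto
    also have "\<dots> \<le> (\<integral>p. envelope f lam (fst p) + lam * dist (fst p) (snd p) \<partial>\<pi>)"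
    proof (rule integral_mono)
      show "f (snd p) \<le> envelope f lam (fst p) + lam * dist (fst p) (snd p)" for p
        using envelope_ge[OF lam, of "snd p" "fst p"] by simp
    qed (use i1 i2 i3 in auto)
    also have "\<dots> = (\<integral>p. envelope f lam (fst p) \<partial>\<pi>) + lam * (\<integral>p. dist (fst p) (snd p) \<partial>\<pi>)"
      using i2 i3 by simp
    also have "(\<integral>p. envelope f lam (fst p) \<partial>\<pi>) = integral\<^sup>L Q (envelope f lam)"
      unfolding Q[symmetric] by (rule integral_distr[symmetric]) auto
    also have "lam * (\<integral>p. dist (fst p) (snd p) \<partial>\<pi>) \<le> lam * (eps + e')"
      using c' lam by (rule mult_left_mono)
    also have "lam * (eps + e') \<le> lam * eps + e"
      using lam e by (simp add: e'_def field_simps)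
    finally show "r \<le> lam * eps + integral\<^sup>L Q (envelope f lam) + e" by simp
  qed
qed

section \<open>Strong duality for empirical distributions\<close>

abbreviation val :: "('z \<times> 'z) pmf \<Rightarrow> real" where
  "val p \<equiv> measure_pmf.expectation p (\<lambda>x. f (snd x))"

text \<open>The plan, restricted to Borel sets, couples the empirical distribution with its second
  marginal, which therefore lies in the Wasserstein ball.\<close>

lemma val_le_worst_risk:
  assumes n: "n > 0" and p: "p \<in> plans n zs" and c: "cost p \<le> eps"
  shows "val p \<le> worst_risk eps (emp_dist n zs) f"
proof -
  define \<pi> where "\<pi> = distr (measure_pmf p) (borel :: ('z \<times> 'z) measure) (\<lambda>x. x)"
  define Q' where "Q' = distr (measure_pmf p) (borel :: 'z measure) snd"
  note m [measurable] = coupling_dist_measurable[of "borel :: ('z \<times> 'z) measure", OF refl]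
  have "distr \<pi> borel fst = distr (measure_pmf p) borel fst"
    unfolding \<pi>_def by (subst distr_distr) (auto simp: comp_def)
  also have "\<dots> = distr (distr (measure_pmf p) (count_space UNIV) fst) borel (\<lambda>x. x)"
    by (subst distr_distr) (auto simp: comp_def)
  also have "\<dots> = distr (measure_pmf (map_pmf fst p)) borel (\<lambda>x. x)"
    by (simp add: map_pmf_rep_eq)
  also have "\<dots> = emp_dist n zs"
    using p emp_dist_pmf[OF n, of zs] by (simp add: plans_def)
  finally have d1: "distr \<pi> borel fst = emp_dist n zs" .
  have d2: "distr \<pi> borel snd = Q'"
    unfolding \<pi>_def Q'_def by (subst distr_distr) (auto simp: comp_def)
  have "\<pi> \<in> couplings (emp_dist n zs) Q'"
    unfolding couplings_def using d1 d2
    by (auto simp: \<pi>_def intro!: measure_pmf.prob_space_distr)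
  then have "W1 (emp_dist n zs) Q' \<le> (\<integral>\<^sup>+ p. ennreal (dist (fst p) (snd p)) \<partial>\<pi>)"
    unfolding W1_def by (rule INF_lower)
  also have "\<dots> = (\<integral>\<^sup>+ x. ennreal (dist (fst x) (snd x)) \<partial>measure_pmf p)"
    unfolding \<pi>_def by (subst nn_integral_distr) auto
  also have "\<dots> = ennreal (cost p)"
    unfolding cost_def case_prod_beta
    using p by (intro nn_integral_eq_integral integrable_measure_pmf_finite) (auto simp: plans_def)
  also have "\<dots> \<le> ennreal eps" using c by (rule ennreal_leI)
  finally have W: "W1 (emp_dist n zs) Q' \<le> ennreal eps" .
  have "val p = integral\<^sup>L Q' f"
    unfolding Q'_def by (rule integral_distr[symmetric]) auto
  then show ?thesis
    unfolding worst_risk_def using W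
    by (intro cSup_upper worst_risk_bdd) (auto simp: Q'_def intro!: measure_pmf.prob_space_distr exI[of _ Q'])
qed

lemma val_bounds: "0 \<le> val p" "val p \<le> M"
proof -
  have "integrable (measure_pmf p) (\<lambda>x. f (snd x))"
    by (rule measure_pmf.integrable_const_bound[where B = M]) (use f_nonneg f_le in auto)
  then show "val p \<le> M" by (intro measure_pmf.integral_le_const) (use f_le in auto)
  show "0 \<le> val p" using f_nonneg by simp
qed

text \<open>The value function of the primal problem, with the transport budget \<open>c\<close> as
  perturbation parameter.\<close>

definition best_val :: "nat \<Rightarrow> (nat \<Rightarrow> 'z) \<Rightarrow> real \<Rightarrow> real" where
  "best_val n zs c = (SUP p\<in>{p \<in> plans n zs. cost p \<le> c}. val p)"

lemma val_le_best_val: "p \<in> plans n zs \<Longrightarrow> cost p \<le> c \<Longrightarrow> val p \<le> best_val n zs c"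
  unfolding best_val_def by (rule cSUP_upper) (auto intro!: bdd_aboveI[of _ M] val_bounds)

text \<open>Drawing the index rather than the point keeps the multiplicity of repeated samples. With
  \<open>w = zs\<close> this is the plan of zero cost.\<close>

lemma graph_plan:
  fixes zs w :: "nat \<Rightarrow> 'z"
  assumes "n > 0"
  defines "p \<equiv> map_pmf (\<lambda>i. (zs i, w i)) (pmf_of_set {..<n})"
  shows "p \<in> plans n zs" "cost p = (\<Sum>i<n. dist (zs i) (w i)) / n" "val p = (\<Sum>i<n. f (w i)) / n"
proof -
  have ne: "{..<n} \<noteq> {}" using assms by auto
  show "p \<in> plans n zs"
    using ne by (simp add: plans_def p_def map_pmf_comp)
  show "cost p = (\<Sum>i<n. dist (zs i) (w i)) / n" "val p = (\<Sum>i<n. f (w i)) / n"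
    using ne by (simp_all add: cost_def p_def integral_pmf_of_set)
qed

lemma plans_ne:
  fixes zs :: "nat \<Rightarrow> 'z"
  assumes "n > 0" "0 \<le> c" shows "{p \<in> plans n zs. cost p \<le> c} \<noteq> {}"
  using graph_plan[OF assms(1), of zs zs] assms(2) by auto

lemma near_best_plan:
  assumes "n > 0" "0 \<le> c" "0 < e"
  obtains p where "p \<in> plans n zs" "cost p \<le> c" "best_val n zs c - e < val p"
proof -
  have "best_val n zs c - e < best_val n zs c" using assms by simp
  then obtain p where "p \<in> {p \<in> plans n zs. cost p \<le> c}" "best_val n zs c - e < val p"
    unfolding best_val_def using plans_ne[OF assms(1,2)]
    by (subst (asm) less_cSUP_iff) (auto intro!: bdd_aboveI[of _ M] val_bounds)
  then show ?thesis using that by auto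
qed

text \<open>Cost and value are affine under mixing, so mixing nearly optimal plans for two budgets
  yields an admissible plan for the mixed budget.\<close>

lemma best_val_concave:
  assumes n: "n > 0" shows "convex_on {0..} (\<lambda>c. - best_val n zs c)"
proof (rule convex_onI)
  fix t x y :: real assume t: "0 < t" "t < 1" and x: "x \<in> {0..}" and y: "y \<in> {0..}"
  have "(1 - t) * best_val n zs x + t * best_val n zs y \<le> best_val n zs ((1 - t) * x + t * y)"
  proof (rule field_le_epsilon)
    fix e :: real assume e: "0 < e"
    obtain p where p: "p \<in> plans n zs" "cost p \<le> x" "best_val n zs x - e < val p"
      using near_best_plan[OF n _ e] x by auto
    obtain q where q: "q \<in> plans n zs" "cost q \<le> y" "best_val n zs y - e < val q"
      using near_best_plan[OF n _ e] y by auto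
    let ?r = "bernoulli_pmf t \<bind> (\<lambda>b. if b then q else p)"
    have fin: "finite (set_pmf p)" "finite (set_pmf q)" using p q by (auto simp: plans_def)
    have cr: "cost ?r = t * cost q + (1 - t) * cost p"
      unfolding cost_def using t fin by (intro expectation_mix_pmf) auto
    have vr: "val ?r = t * val q + (1 - t) * val p"
      using t fin by (intro expectation_mix_pmf) auto
    have "cost ?r \<le> (1 - t) * x + t * y"
      unfolding cr using t p q by (simp add: add.commute add_mono mult_left_mono)
    then have "val ?r \<le> best_val n zs ((1 - t) * x + t * y)"
      by (intro val_le_best_val mix_in_plans p q)
    moreover have "(1 - t) * (best_val n zs x - e) \<le> (1 - t) * val p" "t * (best_val n zs y - e) \<le> t * val q"
      using t p q by (auto intro!: mult_left_mono)
    ultimately show "(1 - t) * best_val n zs x + t * best_val n zs y \<le> best_val n zs ((1 - t) * x + t * y) + e"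
      unfolding vr by (simp add: algebra_simps)
  qed
  then show "- best_val n zs ((1 - t) *\<^sub>R x + t *\<^sub>R y) \<le> (1 - t) * - best_val n zs x + t * - best_val n zs y"
    by simp
qed simp

text \<open>A supergradient of the concave function \<^term>\<open>best_val n zs\<close> at \<^term>\<open>eps\<close> is an optimal dual
  multiplier. It exists because \<^term>\<open>eps\<close> is interior to the domain, so the case
  \<^term>\<open>eps = 0\<close> is excluded here.\<close>

lemma strong_duality:
  assumes n: "n > 0" and eps: "0 < eps"
  obtains lam where "0 \<le> lam" "lam * eps + (\<Sum>i<n. envelope f lam (zs i)) / n \<le> worst_risk eps (emp_dist n zs) f"
proof -
  define V where "V = best_val n zs"
  have "\<exists>G. \<forall>c\<ge>0. - V c \<ge> - V eps + G * (c - eps)"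
    using convex_le_Inf_differential[OF best_val_concave[OF n, of zs], of eps] eps
    unfolding V_def by auto
  then obtain G where G: "\<And>c. 0 \<le> c \<Longrightarrow> - V c \<ge> - V eps + G * (c - eps)" by blast
  define lam where "lam = - G"
  have sup: "V c \<le> V eps + lam * (c - eps)" if "0 \<le> c" for c using G[OF that] by (simp add: lam_def)
  \<comment> \<open>A larger budget admits more plans; comparing with \<open>eps + 1\<close> in
    \<open>sup\<close> then forces the multiplier to be nonnegative.\<close>
  have mono: "V eps \<le> V (eps + 1)"
    unfolding V_def best_val_def using plans_ne[OF n less_imp_le[OF eps]]
    by (rule cSUP_subset_mono) (auto intro!: bdd_aboveI[of _ M] val_bounds)
  have lam: "0 \<le> lam" using sup[of "eps + 1"] mono eps by simp
  have "(\<Sum>i<n. envelope f lam (zs i)) / n \<le> V eps - lam * eps"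
  proof (rule field_le_epsilon)
    fix e :: real assume e: "0 < e"
    \<comment> \<open>Near-maximisers of the envelopes at the sample points define a deterministic
      plan. The supergradient inequality is applied at the cost of this plan.\<close>
    have "\<exists>w. envelope f lam (zs i) - e < f w - lam * dist (zs i) w" for i
      using less_cSUP_iff[OF UNIV_not_empty envelope_bdd[OF lam], of "envelope f lam (zs i) - e" "zs i"] e
      by (auto simp: envelope_def[symmetric])
    then obtain w where w: "\<And>i. envelope f lam (zs i) - e < f (w i) - lam * dist (zs i) (w i)" by metis
    define p where "p = map_pmf (\<lambda>i. (zs i, w i)) (pmf_of_set {..<n})"
    note gp = graph_plan[OF n, of zs w, folded p_def]
    have "(\<Sum>i<n. envelope f lam (zs i)) \<le> (\<Sum>i<n. f (w i) - lam * dist (zs i) (w i) + e)"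
      using w by (intro sum_mono) (simp add: less_imp_le diff_less_eq)
    also have "\<dots> = (\<Sum>i<n. f (w i)) - lam * (\<Sum>i<n. dist (zs i) (w i)) + n * e"
      by (simp add: sum.distrib sum_subtractf sum_distrib_left)
    finally have "(\<Sum>i<n. envelope f lam (zs i)) / n \<le> val p - lam * cost p + e"
      using n unfolding gp by (simp add: field_simps)
    also have "val p \<le> V (cost p)"
      unfolding V_def using gp(1) by (rule val_le_best_val) simp
    also have "V (cost p) \<le> V eps + lam * (cost p - eps)"
      by (rule sup) (simp add: gp sum_nonneg)
    finally show "(\<Sum>i<n. envelope f lam (zs i)) / n \<le> V eps - lam * eps + e"
      by (simp add: algebra_simps)
  qed
  moreover have "V eps \<le> worst_risk eps (emp_dist n zs) f"
    unfolding V_def best_val_def using plans_ne[OF n less_imp_le[OF eps]]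
    by (rule cSUP_least) (auto intro: val_le_worst_risk[OF n])
  ultimately show ?thesis using lam by (intro that[of lam]) auto
qed

section \<open>The interval of multipliers\<close>

text \<open>The radius is absent because the terms \<open>lam * eps\<close> of the two dual
  objectives cancel.\<close>

definition emp_gap :: "'z measure \<Rightarrow> nat \<Rightarrow> real \<Rightarrow> (nat \<Rightarrow> 'z) \<Rightarrow> real" where
  "emp_gap P n lam zs = integral\<^sup>L P (envelope f lam) - (\<Sum>i<n. envelope f lam (zs i)) / n"

lemma psi_nonneg: "0 \<le> lam \<Longrightarrow> 0 \<le> psi f n zs lam"
  by (auto simp: psi_envelope envelope_ge_f intro!: divide_nonneg_nonneg sum_nonneg)

lemma psi_antimono: "0 \<le> lam \<Longrightarrow> lam \<le> mu \<Longrightarrow> psi f n zs mu \<le> psi f n zs lam"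
  by (auto simp: psi_envelope intro!: divide_right_mono sum_mono envelope_antimono)

lemma psi_lipschitz:
  assumes n: "n > 0" and "0 \<le> lam" "lam \<le> mu"
  shows "psi f n zs lam \<le> psi f n zs mu + (mu - lam) * D"
proof -
  have "(\<Sum>i<n. envelope f lam (zs i) - f (zs i)) \<le> (\<Sum>i<n. (envelope f mu (zs i) - f (zs i)) + (mu - lam) * D)"
    using envelope_lipschitz_param[OF assms(2,3)] by (intro sum_mono) (simp add: algebra_simps)
  also have "\<dots> = (\<Sum>i<n. envelope f mu (zs i) - f (zs i)) + n * ((mu - lam) * D)"
    by (simp add: sum.distrib)
  finally show ?thesis
    using n assms by (simp add: psi_envelope field_simps)
qed

text \<open>The growth condition at finitely many sample points gives a common slope, so zeros of
  \<open>psi\<close> exist; Lipschitz dependence on the multiplier makes their infimum a zero as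
  well.\<close>

lemma lam_plus_props:
  fixes zs :: "nat \<Rightarrow> 'z"
  assumes n: "n > 0" and A3: "\<And>z. \<exists>lam. \<forall>z'. f z' - f z \<le> lam * dist z z'"
  shows "0 \<le> lam_plus f n zs" "psi f n zs (lam_plus f n zs) = 0"
proof -
  define S where "S = {lam. lam \<ge> 0 \<and> psi f n zs lam = 0}"
  obtain L where L: "\<And>z z'. f z' - f z \<le> L z * dist z z'" using A3 by metis
  \<comment> \<open>The sum of absolute values dominates the slope at every sample point and is
    nonnegative.\<close>
  define l0 where "l0 = (\<Sum>i<n. \<bar>L (zs i)\<bar>)"
  have l0: "0 \<le> l0" by (simp add: l0_def sum_nonneg)
  have "envelope f l0 (zs i) = f (zs i)" if i: "i < n" for i
  proof (rule antisym[OF envelope_le envelope_ge_f[OF l0]])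
    fix z'
    have "\<bar>L (zs i)\<bar> \<le> l0" unfolding l0_def using i by (intro member_le_sum) auto
    then have "L (zs i) * dist (zs i) z' \<le> l0 * dist (zs i) z'" by (intro mult_right_mono) auto
    then show "f z' - l0 * dist (zs i) z' \<le> f (zs i)" using L[of z' "zs i"] by simp
  qed
  then have "l0 \<in> S" using l0 by (simp add: S_def psi_envelope)
  then have ne: "S \<noteq> {}" by auto
  have bb: "bdd_below S" by (rule bdd_belowI[of _ 0]) (simp add: S_def)
  show ge: "0 \<le> lam_plus f n zs"
    unfolding lam_plus_def S_def[symmetric] using ne by (rule cInf_greatest) (simp add: S_def)
  have "psi f n zs (lam_plus f n zs) \<le> 0"
  proof (rule field_le_epsilon)
    fix e :: real assume e: "0 < e"
    \<comment> \<open>Dividing by \<open>D + 1\<close> avoids a separate case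
      \<open>D = 0\<close>.\<close>
    have D1: "0 < D + 1" using D_nonneg by simp
    have "Inf S < lam_plus f n zs + e / (D + 1)"
      unfolding lam_plus_def S_def using e D1 by simp
    then obtain s where s: "s \<in> S" "s < lam_plus f n zs + e / (D + 1)"
      using cInf_less_iff[OF ne bb] by auto
    have "lam_plus f n zs \<le> s"
      unfolding lam_plus_def S_def[symmetric] using s(1) bb by (rule cInf_lower)
    then have "psi f n zs (lam_plus f n zs) \<le> psi f n zs s + (s - lam_plus f n zs) * D"
      by (rule psi_lipschitz[OF n ge])
    also have "\<dots> \<le> e / (D + 1) * D"
    proof -
      have "(s - lam_plus f n zs) * D \<le> e / (D + 1) * D"
        by (rule mult_right_mono) (use s D_nonneg in auto)
      then show ?thesis using s(1) by (simp add: S_def)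
    qed
    also have "\<dots> \<le> 0 + e" using e D_nonneg by (simp add: field_simps)
    finally show "psi f n zs (lam_plus f n zs) \<le> 0 + e" .
  qed
  then show "psi f n zs (lam_plus f n zs) = 0" using psi_nonneg[OF ge, of n zs] by simp
qed

text \<open>For the third claim, some point of the level set lies to the right of
  \<open>lam\<close>, and \<open>psi\<close> is nonincreasing. For an empty level set the default
  \<open>0\<close> makes that claim vacuous.\<close>

lemma lam_minus_props:
  fixes zs :: "nat \<Rightarrow> 'z"
  assumes n: "n > 0" and A3: "\<And>z. \<exists>lam. \<forall>z'. f z' - f z \<le> lam * dist z z'"
  shows "0 \<le> lam_minus eps f n zs" "lam_minus eps f n zs \<le> lam_plus f n zs"
    "0 \<le> lam \<Longrightarrow> lam < lam_minus eps f n zs \<Longrightarrow> lam_plus f n zs * eps \<le> psi f n zs lam"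
proof -
  define S where "S = {lam. 0 \<le> lam \<and> lam \<le> lam_plus f n zs \<and> psi f n zs lam = lam_plus f n zs * eps}"
  have lm: "lam_minus eps f n zs = (if S = {} then 0 else Sup S)"
    unfolding lam_minus_def S_def Let_def by (rule refl)
  have ba: "bdd_above S" by (rule bdd_aboveI[of _ "lam_plus f n zs"]) (simp add: S_def)
  note lp = lam_plus_props[OF n A3, of zs]
  show "0 \<le> lam_minus eps f n zs"
  proof (cases "S = {}")
    case False
    then obtain s where s: "s \<in> S" by auto
    then have "0 \<le> Sup S" using ba by (intro cSup_upper2[OF s]) (auto simp: S_def)
    then show ?thesis by (simp add: lm)
  qed (simp add: lm)
  show "lam_minus eps f n zs \<le> lam_plus f n zs"
  proof (cases "S = {}")
    case False
    then have "Sup S \<le> lam_plus f n zs" by (rule cSup_least) (simp add: S_def)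
    then show ?thesis using False by (simp add: lm)
  qed (simp add: lm lp)
  show "lam_plus f n zs * eps \<le> psi f n zs lam" if lam: "0 \<le> lam" "lam < lam_minus eps f n zs"
  proof -
    have "S \<noteq> {}" using lam by (auto simp: lm)
    then obtain s where "s \<in> S" "lam < s" using lam less_cSup_iff[OF _ ba] by (auto simp: lm)
    then show ?thesis using psi_antimono[of lam s n zs] lam by (simp add: S_def)
  qed
qed

text \<open>For \<^term>\<open>eps = 0\<close> the multiplier \<^term>\<open>lam_plus f n zs\<close> works. Otherwise a dual
  optimal multiplier is pushed into the interval without increasing the dual objective: to \<open>0\<close> if it
  exceeds \<^term>\<open>M / eps\<close>, and to \<^term>\<open>lam_plus f n zs\<close> in the second case of the definition
  of the interval.\<close>

lemma multiplier_in_zeta_interval: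
  fixes zs :: "nat \<Rightarrow> 'z"
  assumes n: "n > 0" and eps: "0 \<le> eps" and A3: "\<And>z. \<exists>lam. \<forall>z'. f z' - f z \<le> lam * dist z z'"
  obtains lam where "0 \<le> lam" "zeta_lo M eps f n zs \<le> ereal lam" "ereal lam \<le> zeta_hi M eps f n zs"
    "lam * eps + (\<Sum>i<n. envelope f lam (zs i)) / n \<le> worst_risk eps (emp_dist n zs) f"
proof -
  define g where "g lam = lam * eps + (\<Sum>i<n. envelope f lam (zs i)) / n" for lam
  define E where "E = (\<Sum>i<n. f (zs i)) / n"
  let ?Lp = "lam_plus f n zs"
  let ?Lm = "lam_minus eps f n zs"
  let ?W = "worst_risk eps (emp_dist n zs) f"
  note lp = lam_plus_props[OF n A3, of zs]
  note lm = lam_minus_props[OF n A3, where zs = zs and eps = eps]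
  have g_psi: "g lam = lam * eps + psi f n zs lam + E" if "0 \<le> lam" for lam
    using that by (simp add: g_def E_def psi_envelope sum_subtractf diff_divide_distrib)
  have gLp: "g ?Lp = ?Lp * eps + E" using g_psi[OF lp(1)] lp(2) by simp
  have g0: "g 0 \<le> M"
  proof -
    have "(\<Sum>i<n. envelope f 0 (zs i)) \<le> (\<Sum>i<n. M)" by (intro sum_mono envelope_le_M) simp
    then show ?thesis using n by (simp add: g_def field_simps)
  qed
  have g_ge: "lam * eps \<le> g lam" if "0 \<le> lam" for lam
    using that by (auto simp: g_def envelope_nonneg intro!: divide_nonneg_nonneg sum_nonneg)
  have EW: "E \<le> ?W"
    using val_le_worst_risk[OF n graph_plan(1)[OF n, of zs zs], of eps] graph_plan(2,3)[OF n, of zs zs] eps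
    by (simp add: E_def)
  obtain lam where lam: "0 \<le> lam" "zeta_lo M eps f n zs \<le> ereal lam" "ereal lam \<le> zeta_hi M eps f n zs" "g lam \<le> ?W"
  proof (cases "eps = 0")
    case True
    \<comment> \<open>Otherwise \<open>lam_plus\<close> is positive, by the convention for division
      by zero, and \<open>M \<le> 0\<close>. Then \<open>f\<close> vanishes and
      \<open>lam_plus\<close> is at most zero, a contradiction.\<close>
    have "\<not> zeta_cond M eps f n zs"
    proof
      assume zc: "zeta_cond M eps f n zs"
      then have Lp: "?Lp > 0" using lp(1) by (auto simp: zeta_cond_def ediv_def split: if_splits)
      then have "M \<le> 0" using zc True by (auto simp: zeta_cond_def ediv_def divide_le_0_iff)
      then have M: "M = 0" using M_nonneg by simp
      have "psi f n zs 0 = 0"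
      proof -
        have "f z = 0" for z using f_nonneg[of z] f_le[of z] M by simp
        moreover have "envelope f 0 z = 0" for z
          using envelope_nonneg[of 0 z] envelope_le_M[of 0 z] M by simp
        ultimately show ?thesis by (simp add: psi_envelope)
      qed
      then have "?Lp \<le> 0" unfolding lam_plus_def by (intro cInf_lower bdd_belowI[of _ 0]) auto
      then show False using Lp by simp
    qed
    then show ?thesis
      using that[of ?Lp] lp lm gLp EW True by (simp add: zeta_lo_def zeta_hi_def)
  next
    case False
    then have e: "0 < eps" using eps by simp
    obtain lam where l: "0 \<le> lam" "g lam \<le> ?W"
      using strong_duality[OF n e, of zs] unfolding g_def by blast
    show ?thesis
    proof (cases "zeta_cond M eps f n zs")
      case True
      show ?thesis
      proof (cases "lam \<le> M / eps")
        case le: True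
        then show ?thesis using that[of lam] l True e by (simp add: zeta_lo_def zeta_hi_def ediv_def)
      next
        \<comment> \<open>The dual objective is at most \<open>M\<close> at \<open>0\<close>, but at
          least \<open>lam * eps > M\<close> at \<open>lam\<close>.\<close>
        case False
        then have "M < lam * eps" using e by (simp add: field_simps)
        then have "g 0 \<le> ?W" using g0 g_ge[OF l(1)] l(2) by simp
        then show ?thesis using that[of 0] True e M_nonneg by (simp add: zeta_lo_def zeta_hi_def ediv_def)
      qed
    next
      case False
      then have z: "zeta_lo M eps f n zs = ?Lm" "zeta_hi M eps f n zs = ?Lp"
        by (simp_all add: zeta_lo_def zeta_hi_def)
      show ?thesis
      proof (cases "?Lm \<le> lam \<and> lam \<le> ?Lp")
        case True
        then show ?thesis using that[of lam] l z by simp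
      next
        case out: False
        \<comment> \<open>To the left of the interval \<open>psi\<close> alone outweighs
          \<open>lam_plus * eps\<close>; to the right the budget term does.\<close>
        have "g ?Lp \<le> g lam"
        proof (cases "lam < ?Lm")
          case True
          have "0 \<le> lam * eps" using l eps by simp
          then show ?thesis using lm(3)[OF l(1) True] g_psi[OF l(1)] gLp by linarith
        next
          case False
          then have "?Lp \<le> lam" using out by simp
          then have "?Lp * eps \<le> lam * eps" using eps by (rule mult_right_mono)
          then show ?thesis using g_psi[OF l(1)] gLp psi_nonneg[OF l(1), of n zs] by simp
        qed
        then show ?thesis using that[of ?Lp] l lp lm z by simp
      qed
    qed
  qed
  then show ?thesis using that unfolding g_def by blast
qed

section \<open>Uniform deviation over the multipliers\<close>

text \<open>One event serves all multipliers in the interval. Of the factor \<open>2\<close>, one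
  half bounds the mean of the maximum over a grid, the other the distance to the grid.\<close>

lemma uniform_deviation:
  fixes P :: "'z measure"
  assumes "prob_space P" and sP [measurable_cong]: "sets P = sets borel"
    and n: "n > 0" and a: "0 \<le> a" and ab: "a \<le> b" and M: "0 < M" and \<delta>: "0 < \<delta>" "\<delta> < 1"
  shows "\<exists>A\<in>sets (PiM {..<n} (\<lambda>_. P)). measure (PiM {..<n} (\<lambda>_. P)) A \<ge> 1 - \<delta> \<and>
    (\<forall>zs\<in>A. \<forall>lam\<in>{a..b}. emp_gap P n lam zs
        \<le> M * sqrt (ln (1 / \<delta>) / (2 * n)) + 2 * ((b - a) * D / sqrt n))"
proof -
  interpret P: prob_space P by fact
  define PP where "PP = PiM {..<n} (\<lambda>_. P)"
  interpret PP: prob_space PP unfolding PP_def by (rule prob_space_PiM) (rule assms(1))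
  \<comment> \<open>The bound on the total variation does not depend on the number of steps;
    \<open>n\<close> steps make the grid error small enough.\<close>
  define h where "h = (b - a) / n"
  define l where "l j = a + real j * h" for j :: nat
  have h0: "0 \<le> h" using ab by (simp add: h_def)
  have l0: "0 \<le> l j" for j using a h0 by (simp add: l_def)
  have l_Suc: "l (Suc j) - l j = h" "l j \<le> l (Suc j)" for j
    using h0 by (auto simp: l_def algebra_simps)
  have env_m [measurable]: "envelope f (l j) \<in> borel_measurable P" for j
    using envelope_measurable[OF l0[of j]] measurable_cong_sets[OF sP refl] by blast
  have env_bd: "0 \<le> envelope f (l j) z" "envelope f (l j) z \<le> M" for j z
    using envelope_nonneg envelope_le_M l0 by auto
  have env_int: "integrable P (envelope f lam)" if "0 \<le> lam" for lam
  proof (rule P.integrable_const_bound[where B = M])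
    show "envelope f lam \<in> borel_measurable P"
      using envelope_measurable[OF that] measurable_cong_sets[OF sP refl] by blast
  qed (use envelope_nonneg[OF that] envelope_le_M[OF that] in auto)
  define X where "X j zs = emp_gap P n (l j) zs" for j zs
  have Xm [measurable]: "X j \<in> borel_measurable PP" for j
    unfolding X_def emp_gap_def PP_def by measurable
  have XB: "\<bar>X j zs\<bar> \<le> M" for j zs
  proof -
    have "0 \<le> integral\<^sup>L P (envelope f (l j))" "integral\<^sup>L P (envelope f (l j)) \<le> M"
      using env_bd env_int[OF l0] by (auto intro!: integral_nonneg P.integral_le_const)
    moreover have "0 \<le> (\<Sum>i<n. envelope f (l j) (zs i)) / n" "(\<Sum>i<n. envelope f (l j) (zs i)) / n \<le> M"
      using env_bd n sum_bounded_above[of "{..<n}" "\<lambda>i. envelope f (l j) (zs i)" M]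
      by (auto simp: field_simps intro!: divide_nonneg_nonneg sum_nonneg)
    ultimately show ?thesis unfolding X_def emp_gap_def by linarith
  qed
  have X_int: "integrable PP (X j)" for j
    by (rule PP.integrable_const_bound[where B = M]) (use XB in auto)
  \<comment> \<open>Replacing one sample changes a single summand, and envelopes take values in
    \<open>[0, M]\<close>.\<close>
  have Xd: "\<bar>X j (zs(i := y)) - X j zs\<bar> \<le> M / n" if "i < n" for j zs i y
  proof -
    have eq: "(\<Sum>k<n. envelope f (l j) ((zs(i := y)) k))
        = (\<Sum>k<n. envelope f (l j) (zs k)) - envelope f (l j) (zs i) + envelope f (l j) y"
    proof -
      have "(\<Sum>k<n. envelope f (l j) ((zs(i := y)) k)) = envelope f (l j) y + (\<Sum>k\<in>{..<n}-{i}. envelope f (l j) (zs k))"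
        using that by (subst sum.remove[of _ i]) auto
      moreover have "(\<Sum>k<n. envelope f (l j) (zs k)) = envelope f (l j) (zs i) + (\<Sum>k\<in>{..<n}-{i}. envelope f (l j) (zs k))"
        using that by (subst sum.remove[of _ i]) auto
      ultimately show ?thesis by simp
    qed
    have "X j (zs(i := y)) - X j zs = (envelope f (l j) (zs i) - envelope f (l j) y) / n"
      unfolding X_def emp_gap_def eq by (simp add: diff_divide_distrib add_divide_distrib)
    moreover have "\<bar>envelope f (l j) (zs i) - envelope f (l j) y\<bar> \<le> M"
      using env_bd[of j "zs i"] env_bd[of j y] by linarith
    ultimately show ?thesis by (simp add: divide_right_mono)
  qed
  \<comment> \<open>A finite maximum is measurable and inherits the bounded differences of the
    \<open>X j\<close>.\<close>
  define Z where "Z zs = Max ((\<lambda>j. X j zs) ` {..n})" for zs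
  have Zm [measurable]: "Z \<in> borel_measurable PP"
    unfolding Z_def by measurable
  have X_Z: "X j zs \<le> Z zs" if "j \<le> n" for j zs
    unfolding Z_def using that by (intro Max_ge) auto
  have Z_ex: "\<exists>j\<le>n. Z zs = X j zs" for zs
  proof -
    have "Z zs \<in> (\<lambda>j. X j zs) ` {..n}" unfolding Z_def by (intro Max_in) auto
    then show ?thesis by auto
  qed
  have ZB: "\<bar>Z zs\<bar> \<le> M" for zs
    using Z_ex[of zs] XB by auto
  have Zd: "\<bar>Z (zs(i := y)) - Z zs\<bar> \<le> M / n" if i: "i < n" for zs i y
  proof -
    obtain j k where j: "j \<le> n" "Z zs = X j zs" and k: "k \<le> n" "Z (zs(i := y)) = X k (zs(i := y))"
      using Z_ex by meson
    show ?thesis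
      using X_Z[OF j(1), of "zs(i := y)"] X_Z[OF k(1), of zs] Xd[OF i, of j zs y] Xd[OF i, of k zs y] j k
      by linarith
  qed
  have EX0: "PP.expectation (X j) = 0" for j
  proof -
    have comp: "integrable PP (\<lambda>zs. envelope f (l j) (zs i))"
      "PP.expectation (\<lambda>zs. envelope f (l j) (zs i)) = integral\<^sup>L P (envelope f (l j))" if "i < n" for i
    proof -
      have [measurable]: "(\<lambda>zs. zs i) \<in> PP \<rightarrow>\<^sub>M P" unfolding PP_def using that by (intro measurable_component_singleton) auto
      show "integrable PP (\<lambda>zs. envelope f (l j) (zs i))"
        by (rule PP.integrable_const_bound[where B = M]) (use env_bd in auto)
      have "distr PP P (\<lambda>zs. zs i) = P"
        unfolding PP_def using that assms(1) by (intro distr_PiM_component) auto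
      then have "integral\<^sup>L P (envelope f (l j)) = integral\<^sup>L (distr PP P (\<lambda>zs. zs i)) (envelope f (l j))" by simp
      also have "\<dots> = PP.expectation (\<lambda>zs. envelope f (l j) (zs i))"
        by (rule integral_distr) auto
      finally show "PP.expectation (\<lambda>zs. envelope f (l j) (zs i)) = integral\<^sup>L P (envelope f (l j))" by simp
    qed
    have "PP.expectation (X j) = integral\<^sup>L P (envelope f (l j)) - (\<Sum>i<n. PP.expectation (\<lambda>zs. envelope f (l j) (zs i))) / n"
    proof -
      have "integrable PP (\<lambda>zs. \<Sum>i<n. envelope f (l j) (zs i))"
        using comp(1) by (intro Bochner_Integration.integrable_sum) auto
      moreover have "PP.expectation (\<lambda>zs. \<Sum>i<n. envelope f (l j) (zs i))
          = (\<Sum>i<n. PP.expectation (\<lambda>zs. envelope f (l j) (zs i)))"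
        using comp(1) by (intro Bochner_Integration.integral_sum) auto
      ultimately show ?thesis
        unfolding X_def emp_gap_def by (simp add: PP.prob_space)
    qed
    then show ?thesis using comp(2) n by simp
  qed
  \<comment> \<open>The one-parameter process is controlled through its total variation along the grid, which
    needs only second moments of the increments; no chaining or symmetrization is involved.\<close>
  have Einc: "PP.expectation (\<lambda>zs. \<bar>X (Suc j) zs - X j zs\<bar>) \<le> h * D / sqrt n" for j
  proof -
    define w where "w y = envelope f (l (Suc j)) y - envelope f (l j) y" for y
    define u where "u y = (integral\<^sup>L P w - w y) / n" for y
    have wb: "- (h * D) \<le> w y" "w y \<le> 0" for y
      using envelope_lipschitz_param[OF l0 l_Suc(2), of j y] envelope_antimono[OF l0 l_Suc(2), of j y]
      by (auto simp: w_def l_Suc(1))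
    have wint: "integrable P w" unfolding w_def using env_int l0 by auto
    have wm [measurable]: "w \<in> borel_measurable P" unfolding w_def by measurable
    have Ew: "- (h * D) \<le> integral\<^sup>L P w" "integral\<^sup>L P w \<le> 0"
      using wint wb by (auto intro!: P.integral_ge_const P.integral_le_const)
    have ub: "\<bar>u y\<bar> \<le> h * D / n" for y
    proof -
      have "\<bar>integral\<^sup>L P w - w y\<bar> \<le> h * D" using Ew wb[of y] by linarith
      then show ?thesis by (simp add: u_def divide_right_mono)
    qed
    have um [measurable]: "u \<in> borel_measurable P" unfolding u_def by measurable
    have u0: "integral\<^sup>L P u = 0" unfolding u_def using wint by (simp add: P.prob_space)
    have diff: "X (Suc j) zs - X j zs = (\<Sum>i<n. u (zs i))" for zs
    proof -
      have "integral\<^sup>L P w = integral\<^sup>L P (envelope f (l (Suc j))) - integral\<^sup>L P (envelope f (l j))"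
        unfolding w_def using env_int l0 by simp
      moreover have "(\<Sum>i<n. u (zs i)) = integral\<^sup>L P w - (\<Sum>i<n. w (zs i)) / n"
        using n by (simp add: u_def sum_divide_distrib[symmetric] sum_subtractf diff_divide_distrib)
      moreover have "(\<Sum>i<n. w (zs i)) = (\<Sum>i<n. envelope f (l (Suc j)) (zs i)) - (\<Sum>i<n. envelope f (l j) (zs i))"
        by (simp add: w_def sum_subtractf)
      ultimately show ?thesis
        by (simp add: X_def emp_gap_def diff_divide_distrib)
    qed
    have int2: "integrable PP (\<lambda>zs. (X (Suc j) zs - X j zs)\<^sup>2)"
    proof (rule PP.integrable_const_bound[where B = "(2 * M)\<^sup>2"])
      show "AE zs in PP. norm ((X (Suc j) zs - X j zs)\<^sup>2) \<le> (2 * M)\<^sup>2"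
      proof (rule AE_I2)
        fix zs
        have "\<bar>X (Suc j) zs - X j zs\<bar> \<le> 2 * M" using XB[of "Suc j" zs] XB[of j zs] by linarith
        then show "norm ((X (Suc j) zs - X j zs)\<^sup>2) \<le> (2 * M)\<^sup>2"
          using M power2_le_iff_abs_le[of "2 * M" "X (Suc j) zs - X j zs"] by simp
      qed
    qed measurable
    have "PP.expectation (\<lambda>zs. (X (Suc j) zs - X j zs)\<^sup>2) = (\<Sum>i<n. \<integral>y. (u y)\<^sup>2 \<partial>P)"
      unfolding diff PP_def
      by (rule second_moment_sum_PiM[where B = "h * D / n"]) (use assms(1) ub u0 in auto)
    also have "\<dots> \<le> (\<Sum>i<n. (h * D / n)\<^sup>2)"
    proof (rule sum_mono)
      have ub2: "(u y)\<^sup>2 \<le> (h * D / n)\<^sup>2" for y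
        using ub[of y] h0 D_nonneg by (simp add: power2_le_iff_abs_le)
      have "integrable P (\<lambda>y. (u y)\<^sup>2)"
        by (rule P.integrable_const_bound[where B = "(h * D / n)\<^sup>2"]) (use ub2 in auto)
      then show "(\<integral>y. (u y)\<^sup>2 \<partial>P) \<le> (h * D / n)\<^sup>2"
        by (rule P.integral_le_const) (use ub2 in auto)
    qed
    also have "\<dots> = (h * D / sqrt n)\<^sup>2"
      using n by (simp add: power_divide power2_eq_square field_simps)
    finally have "sqrt (PP.expectation (\<lambda>zs. (X (Suc j) zs - X j zs)\<^sup>2)) \<le> sqrt ((h * D / sqrt n)\<^sup>2)"
      by (rule real_sqrt_le_mono)
    also have "\<dots> = h * D / sqrt n" using h0 D_nonneg by simp
    finally show ?thesis
      using PP.expectation_abs_le_sqrt[OF _ int2] by simp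
  qed
  have tel: "X j zs \<le> X 0 zs + (\<Sum>k<j. \<bar>X (Suc k) zs - X k zs\<bar>)" for j zs
  proof (induction j)
    case (Suc j)
    then show ?case unfolding sum.lessThan_Suc by linarith
  qed simp
  \<comment> \<open>The right side no longer refers to the maximising index, and \<open>X 0\<close>
    has mean zero.\<close>
  have Z_le: "Z zs \<le> X 0 zs + (\<Sum>k<n. \<bar>X (Suc k) zs - X k zs\<bar>)" for zs
  proof -
    obtain j where j: "j \<le> n" "Z zs = X j zs" using Z_ex by blast
    have "(\<Sum>k<j. \<bar>X (Suc k) zs - X k zs\<bar>) \<le> (\<Sum>k<n. \<bar>X (Suc k) zs - X k zs\<bar>)"
      using j by (intro sum_mono2) auto
    then show ?thesis using tel[of j zs] j by simp
  qed
  have Z_int: "integrable PP Z" by (rule PP.integrable_const_bound[where B = M]) (use ZB in auto)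
  have "PP.expectation Z \<le> PP.expectation (\<lambda>zs. X 0 zs + (\<Sum>k<n. \<bar>X (Suc k) zs - X k zs\<bar>))"
    by (rule integral_mono) (use Z_int X_int Z_le in auto)
  also have "\<dots> = (\<Sum>k<n. PP.expectation (\<lambda>zs. \<bar>X (Suc k) zs - X k zs\<bar>))"
    using X_int EX0 by simp
  also have "\<dots> \<le> (\<Sum>k<n. h * D / sqrt n)" by (rule sum_mono) (rule Einc)
  also have "\<dots> = (b - a) * D / sqrt n" using n by (simp add: h_def)
  finally have EZ: "PP.expectation Z \<le> (b - a) * D / sqrt n" .
  \<comment> \<open>With difference constants \<open>M / n\<close> this makes the exponent in
    \<open>mcdiarmid\<close> equal to \<open>- ln (1 / \<delta>)\<close>.\<close>
  define t where "t = M * sqrt (ln (1 / \<delta>) / (2 * n))"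
  have ln_pos: "0 < ln (1 / \<delta>)" using \<delta> by simp
  have t: "0 < t" using M ln_pos n by (simp add: t_def)
  define Bad where "Bad = {zs \<in> space PP. Z zs \<ge> PP.expectation Z + t}"
  have Bad_sets: "Bad \<in> sets PP" unfolding Bad_def by measurable
  have "PP.prob Bad \<le> exp (- (2 * t\<^sup>2 / (\<Sum>i<n. (M / n)\<^sup>2)))"
    unfolding Bad_def PP_def
    by (rule mcdiarmid[where B = M])
       (use assms(1) Zm[unfolded PP_def] ZB Zd M n t in auto)
  also have "2 * t\<^sup>2 / (\<Sum>i<n. (M / n)\<^sup>2) = ln (1 / \<delta>)"
    using M n ln_pos by (simp add: t_def power_mult_distrib power_divide field_simps power2_eq_square[of "real n"])
  also have "exp (- ln (1 / \<delta>)) = \<delta>" using \<delta> by (simp add: ln_div)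
  finally have Bad: "PP.prob Bad \<le> \<delta>" .
  have hDn: "h * D \<le> (b - a) * D / sqrt n"
  proof -
    have "sqrt n \<le> n" using n by (simp add: real_le_lsqrt self_le_power)
    then have "(b - a) * D / n \<le> (b - a) * D / sqrt n"
      using n ab D_nonneg by (intro divide_left_mono) auto
    then show ?thesis by (simp add: h_def)
  qed
  show ?thesis
  proof (intro bexI conjI ballI)
    show "space PP - Bad \<in> sets (PiM {..<n} (\<lambda>_. P))" using Bad_sets unfolding PP_def by auto
    show "1 - \<delta> \<le> measure (PiM {..<n} (\<lambda>_. P)) (space PP - Bad)"
      using PP.prob_compl[OF Bad_sets] Bad unfolding PP_def by simp
    fix zs lam assume zs: "zs \<in> space PP - Bad" and lam: "lam \<in> {a..b}"
    have Zzs: "Z zs \<le> (b - a) * D / sqrt n + t" using zs EZ by (auto simp: Bad_def)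
    obtain j where j: "j \<le> n" "l j \<le> lam" "lam - l j \<le> h"
    proof (cases "h = 0")
      case True
      then have "a = b" using n by (simp add: h_def)
      then show ?thesis using that[of 0] lam True by (simp add: l_def)
    next
      case False
      then have h: "0 < h" using h0 by simp
      define j where "j = nat \<lfloor>(lam - a) / h\<rfloor>"
      have nn: "0 \<le> (lam - a) / h" using lam h by simp
      have "real j \<le> (lam - a) / h" "(lam - a) / h < real j + 1"
        using nn by (auto simp: j_def)
      then have j: "real j * h \<le> lam - a" "lam - a < (real j + 1) * h"
        using h by (simp_all add: field_simps)
      have "real j * h \<le> real n * h" using j(1) lam n by (simp add: h_def)
      then have "j \<le> n" using h by simp
      then show ?thesis using that[of j] j by (simp add: l_def algebra_simps)
    qed
    have lam0: "0 \<le> lam" using lam a by simp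
    \<comment> \<open>The grid point lies to the left of \<open>lam\<close>, so monotonicity handles
      the mean under \<open>P\<close> without loss; only the empirical mean costs
      \<open>h * D\<close>.\<close>
    have "integral\<^sup>L P (envelope f lam) \<le> integral\<^sup>L P (envelope f (l j))"
      using env_int lam0 l0 j by (intro integral_mono envelope_antimono) auto
    moreover have "(\<Sum>i<n. envelope f (l j) (zs i)) / n \<le> (\<Sum>i<n. envelope f lam (zs i)) / n + h * D"
    proof -
      have "(\<Sum>i<n. envelope f (l j) (zs i)) \<le> (\<Sum>i<n. envelope f lam (zs i) + h * D)"
      proof (rule sum_mono)
        fix i
        have "(lam - l j) * D \<le> h * D" using j D_nonneg by (intro mult_right_mono) auto
        then show "envelope f (l j) (zs i) \<le> envelope f lam (zs i) + h * D"
          using envelope_lipschitz_param[OF l0 j(2), of "zs i"] by linarith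
      qed
      then show ?thesis using n by (simp add: sum.distrib field_simps)
    qed
    ultimately have "emp_gap P n lam zs \<le> X j zs + h * D"
      unfolding X_def emp_gap_def by linarith
    also have "\<dots> \<le> Z zs + h * D" using X_Z[OF j(1)] by simp
    finally have "emp_gap P n lam zs \<le> Z zs + h * D" .
    moreover define q where "q = (b - a) * D / sqrt n"
    ultimately show "emp_gap P n lam zs \<le> M * sqrt (ln (1 / \<delta>) / (2 * n)) + 2 * ((b - a) * D / sqrt n)"
      using Zzs hDn unfolding t_def[symmetric] q_def[symmetric] by linarith
  qed
qed

section \<open>Reduction of the risk gap and degenerate cases\<close>

text \<open>Weak duality for \<open>P\<close> is used at the multiplier found for the sample. As
  this multiplier depends on \<open>zs\<close>, a uniform deviation bound is required
  afterwards.\<close>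

lemma risk_gap_le_emp_gap:
  fixes zs :: "nat \<Rightarrow> 'z" and P :: "'z measure"
  assumes "prob_space P" "sets P = sets borel" "n > 0" "0 \<le> eps"
    and A3: "\<And>z. \<exists>lam. \<forall>z'. f z' - f z \<le> lam * dist z z'"
  obtains lam where "0 \<le> lam" "zeta_lo M eps f n zs \<le> ereal lam" "ereal lam \<le> zeta_hi M eps f n zs"
    "worst_risk eps P f - worst_risk eps (emp_dist n zs) f \<le> emp_gap P n lam zs"
proof -
  obtain lam where lam: "0 \<le> lam" "zeta_lo M eps f n zs \<le> ereal lam" "ereal lam \<le> zeta_hi M eps f n zs"
    "lam * eps + (\<Sum>i<n. envelope f lam (zs i)) / n \<le> worst_risk eps (emp_dist n zs) f"
    using multiplier_in_zeta_interval[OF assms(3-5)] by blast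
  then show ?thesis
    using that worst_risk_upper[OF assms(1,2) lam(1) assms(4)] unfolding emp_gap_def by fastforce
qed

text \<open>The space is a single point. This case is separate because in \<open>ereal\<close> an
  infinite \<open>Lambda\<close> times zero is zero.\<close>

lemma emp_gap_le_diameter:
  fixes zs :: "nat \<Rightarrow> 'z" and P :: "'z measure"
  assumes "prob_space P" "sets P = sets borel" and n: "n > 0" and lam: "0 \<le> lam" and D0: "D = 0"
  shows "emp_gap P n lam zs \<le> 0"
proof -
  interpret prob_space P by fact
  have c: "envelope f lam z = envelope f lam undefined" for z
    by (rule arg_cong[of z undefined]) (use dist_le_D[of z undefined] D0 in simp)
  have "integral\<^sup>L P (envelope f lam) = (\<integral>z. envelope f lam undefined \<partial>P)"
    by (rule Bochner_Integration.integral_cong[OF refl c])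
  moreover have "(\<Sum>i<n. envelope f lam (zs i)) = (\<Sum>i<n. envelope f lam undefined)"
    by (rule sum.cong[OF refl c])
  ultimately show ?thesis using n prob_space by (simp add: emp_gap_def)
qed

text \<open>Serves the case \<open>M = 0\<close>, where the difference constants in McDiarmid's
  inequality would vanish.\<close>

lemma emp_gap_le_bound:
  fixes zs :: "nat \<Rightarrow> 'z" and P :: "'z measure"
  assumes "prob_space P" "sets P = sets borel" and n: "n > 0" and lam: "0 \<le> lam"
  shows "emp_gap P n lam zs \<le> M"
proof -
  interpret prob_space P by fact
  have "envelope f lam \<in> borel_measurable P"
    using envelope_measurable[OF lam] measurable_cong_sets[OF assms(2) refl] by blast
  then have "integrable P (envelope f lam)"
    by (rule integrable_const_bound[where B = M, rotated])
       (use envelope_nonneg[OF lam] envelope_le_M[OF lam] in auto)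
  then have "integral\<^sup>L P (envelope f lam) \<le> M"
    by (rule integral_le_const) (use envelope_le_M[OF lam] in auto)
  moreover have "0 \<le> (\<Sum>i<n. envelope f lam (zs i)) / n"
    using envelope_nonneg[OF lam] by (auto intro!: divide_nonneg_nonneg sum_nonneg)
  ultimately show ?thesis unfolding emp_gap_def by linarith
qed

end

section \<open>Assembly of the risk bound\<close>

theorem theorem1:
  fixes P :: "'z::metric_space measure" and F :: "('z \<Rightarrow> real) set"
    and f :: "'z \<Rightarrow> real" and n :: nat and eps M \<delta> :: real
  assumes P: "prob_space P" "sets P = sets (borel :: 'z measure)"
    and n: "n > 0"
    and eps: "eps \<ge> 0"
    and A1: "bounded (UNIV :: 'z set)"
    and A2: "\<forall>g\<in>F. usc g \<and> (\<forall>z. 0 \<le> g z \<and> g z \<le> M)"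
    and A3: "\<forall>g\<in>F. \<forall>z. \<exists>lam. \<forall>z'. g z' - g z \<le> lam * dist z z'"
    and f: "f \<in> F"
    and \<delta>: "0 < \<delta>" "\<delta> < 1"
  shows "\<exists>A\<in>sets (PiM {..<n} (\<lambda>_. P)).
           measure (PiM {..<n} (\<lambda>_. P)) A \<ge> 1 - \<delta> \<and>
           (\<forall>zs\<in>A. ereal (worst_risk eps P f - worst_risk eps (emp_dist n zs) f)
              \<le> 24 * enn2ereal (entropy_integral F) / sqrt (real n)
                + ereal (M * sqrt (ln (1 / \<delta>) / (2 * real n)))
                + ereal (12 * sqrt pi / sqrt (real n)) * Lambda M eps F n
                  * ereal (diameter (UNIV :: 'z set)))"
proof -
  define D where "D = diameter (UNIV :: 'z set)"
  have loc: "bounded_usc g M D" if "g \<in> F" for g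
    using that A2 diameter_bounded_bound[OF A1] by unfold_locales (auto simp: D_def)
  interpret bounded_usc f M D using loc[OF f] .
  interpret PP: prob_space "PiM {..<n} (\<lambda>_. P)" by (rule prob_space_PiM) (rule P)
  have A3f: "\<exists>lam. \<forall>z'. f z' - f z \<le> lam * dist z z'" for z using bspec[OF A3 f] by (rule spec)
  define H where "H = (SUP g\<in>F. SUP zs. zeta_hi M eps g n zs)"
  define L where "L = (INF g\<in>F. INF zs. zeta_lo M eps g n zs)"
  have Lambda: "Lambda M eps F n = H - L" by (simp add: Lambda_def H_def L_def)
  have hi: "zeta_hi M eps f n zs \<le> H" for zs
    unfolding H_def by (rule SUP_upper2[OF f SUP_upper[OF UNIV_I]])
  have lo: "L \<le> zeta_lo M eps f n zs" for zs
    unfolding L_def by (rule INF_lower2[OF f INF_lower[OF UNIV_I]])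
  have lo_nonneg: "0 \<le> zeta_lo M eps g n zs" if g: "g \<in> F" for g zs
    using bounded_usc.lam_minus_props(1)[OF loc[OF g] n spec[OF bspec[OF A3 g]]]
    by (simp add: zeta_lo_def)
  have L0: "0 \<le> L"
    unfolding L_def by (intro INF_greatest lo_nonneg)
  have gap: "\<exists>lam\<ge>0. L \<le> ereal lam \<and> ereal lam \<le> H \<and>
      worst_risk eps P f - worst_risk eps (emp_dist n zs) f \<le> emp_gap P n lam zs" for zs
  proof -
    obtain lam where "0 \<le> lam" "zeta_lo M eps f n zs \<le> ereal lam" "ereal lam \<le> zeta_hi M eps f n zs"
      "worst_risk eps P f - worst_risk eps (emp_dist n zs) f \<le> emp_gap P n lam zs"
      by (rule risk_gap_le_emp_gap[OF P n eps A3f])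
    then show ?thesis using order_trans[OF lo] order_trans[OF _ hi] by blast
  qed
  obtain l0 where l0: "L \<le> ereal l0" "ereal l0 \<le> H" using gap by blast
  \<comment> \<open>\<open>L\<close> lies between \<open>0\<close> and a real number, whereas
    \<open>H\<close> may be infinite.\<close>
  have Lf: "\<bar>L\<bar> \<noteq> \<infinity>" using L0 l0 by auto
  then obtain a where a: "L = ereal a" by auto
  have a0: "0 \<le> a" using L0 a by simp
  have ent: "0 \<le> 24 * enn2ereal (entropy_integral F) / sqrt (real n)"
    using n by (intro zero_le_divide_ereal) auto
  have ln_pos: "0 \<le> ln (1 / \<delta>)" using \<delta> by simp
  then have t0: "0 \<le> M * sqrt (ln (1 / \<delta>) / (2 * real n))" using M_nonneg by simp
  have HL: "0 \<le> H - L" using l0 a by (cases H) auto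
  have last0: "0 \<le> ereal (12 * sqrt pi / sqrt (real n)) * Lambda M eps F n * ereal D"
    unfolding Lambda using HL D_nonneg by simp
  have bound: "ereal x \<le> 24 * enn2ereal (entropy_integral F) / sqrt (real n)
                + ereal (M * sqrt (ln (1 / \<delta>) / (2 * real n)))
                + ereal (12 * sqrt pi / sqrt (real n)) * Lambda M eps F n * ereal D"
    if "ereal x \<le> ereal (M * sqrt (ln (1 / \<delta>) / (2 * real n)))
        + ereal (12 * sqrt pi / sqrt (real n)) * Lambda M eps F n * ereal D" for x
    using add_mono[OF ent that] by (simp add: add.assoc)
  have conclude: ?thesis
    if "A \<in> sets (PiM {..<n} (\<lambda>_. P))" "measure (PiM {..<n} (\<lambda>_. P)) A \<ge> 1 - \<delta>"
      and "\<And>zs. zs \<in> A \<Longrightarrow> ereal (worst_risk eps P f - worst_risk eps (emp_dist n zs) f)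
        \<le> ereal (M * sqrt (ln (1 / \<delta>) / (2 * real n)))
          + ereal (12 * sqrt pi / sqrt (real n)) * Lambda M eps F n * ereal D" for A
    unfolding D_def[symmetric] by (intro bexI[of _ A] conjI ballI bound) (use that in auto)
  have space: "1 - \<delta> \<le> PP.prob (space (PiM {..<n} (\<lambda>_. P)))"
    using \<delta> PP.prob_space by simp
  \<comment> \<open>The stated constant leaves room for the factor \<open>2\<close> of
    \<open>uniform_deviation\<close>.\<close>
  have pi_ge: "2 \<le> 12 * sqrt pi"
  proof -
    have "1 \<le> sqrt pi" using pi_gt3 by (intro real_le_rsqrt) simp
    then show ?thesis by linarith
  qed
  \<comment> \<open>In the first case the gap is nonpositive, in the second the right side is
    infinite, so the whole space serves as event; only the third needs the deviation bound.\<close>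
  consider (D0) "M = 0 \<or> D = 0" | (inf) "H = \<infinity>" "D > 0" | (fin) "M > 0" "H \<noteq> \<infinity>"
    using D_nonneg M_nonneg by force
  then show ?thesis
  proof cases
    case D0
    have "emp_gap P n lam zs \<le> 0" if "0 \<le> lam" for lam zs
      using D0 emp_gap_le_diameter[OF P n that] emp_gap_le_bound[OF P n that] by auto
    then have neg: "worst_risk eps P f - worst_risk eps (emp_dist n zs) f \<le> 0" for zs
      using gap[of zs] by (meson order_trans)
    have "ereal (worst_risk eps P f - worst_risk eps (emp_dist n zs) f) \<le> ereal (M * sqrt (ln (1 / \<delta>) / (2 * real n)))
        + ereal (12 * sqrt pi / sqrt (real n)) * Lambda M eps F n * ereal D" for zs
      by (rule order_trans[OF _ add_nonneg_nonneg[OF _ last0]]) (use t0 neg[of zs] in auto)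
    then show ?thesis
      by (intro conclude[OF sets.top space])
  next
    case inf
    have "ereal (12 * sqrt pi / sqrt (real n)) * Lambda M eps F n * ereal D = \<infinity>"
      unfolding Lambda a inf using n inf by simp
    then show ?thesis
      by (intro conclude[OF sets.top space]) (simp only: plus_ereal.simps ereal_less_eq(1))
  next
    case fin
    then obtain b where b: "H = ereal b" using l0 by (cases H) auto
    have ab: "a \<le> b" using HL a b by simp
    obtain A where A: "A \<in> sets (PiM {..<n} (\<lambda>_. P))" "measure (PiM {..<n} (\<lambda>_. P)) A \<ge> 1 - \<delta>"
      and dev: "\<And>zs lam. zs \<in> A \<Longrightarrow> lam \<in> {a..b} \<Longrightarrow>
        emp_gap P n lam zs \<le> M * sqrt (ln (1 / \<delta>) / (2 * n)) + 2 * ((b - a) * D / sqrt n)"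
      using uniform_deviation[OF P n a0 ab fin(1) \<delta>] by blast
    have "ereal (worst_risk eps P f - worst_risk eps (emp_dist n zs) f) \<le> ereal (M * sqrt (ln (1 / \<delta>) / (2 * real n)))
        + ereal (12 * sqrt pi / sqrt (real n)) * Lambda M eps F n * ereal D" if zs: "zs \<in> A" for zs
    proof -
      obtain lam where lam: "lam \<in> {a..b}"
        "worst_risk eps P f - worst_risk eps (emp_dist n zs) f \<le> emp_gap P n lam zs"
        using gap[of zs] a b by auto
      have "2 * ((b - a) * D / sqrt n) \<le> 12 * sqrt pi * ((b - a) * D / sqrt n)"
        using pi_ge ab D_nonneg by (intro mult_right_mono) auto
      then have "worst_risk eps P f - worst_risk eps (emp_dist n zs) f
          \<le> M * sqrt (ln (1 / \<delta>) / (2 * real n)) + 12 * sqrt pi / sqrt (real n) * (b - a) * D"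
        using dev[OF zs lam(1)] lam(2) by (simp add: ac_simps)
      then show ?thesis by (simp add: Lambda a b)
    qed
    then show ?thesis by (rule conclude[OF A])
  qed
qed

end
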